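(* Let $\mathsf{M}$ be a sparse paving matroid of rank $k$ on $n$ elements. Then (1) the coefficient sequence of $Y_{\mathsf{M}}(t)$ is unimodal; and (2) the coefficient sequence of $Y_{\mathsf{M}}(t)$ is log-concave with no internal zeros.
   Context: A matroid is paving if every circuit has size at least its rank, and sparse paving if it and its dual are paving. For a matroid $\mathsf{M}$, $\mathcal{L}(\mathsf{M})$ is its lattice of flats, $\mathsf{M}|_F$, $\mathsf{M}/F$ restriction and contraction, $\mathrm{rk}(\mathsf{M}/F)=\mathrm{rk}(\mathsf{M})-\mathrm{rk}(F)$. For loopless $\mathsf{M}$, $\mu_{\mathsf{M}}=\mu(\emptyset,E)$ in $\mathcal{L}(\mathsf{M})$ ($=1$ in rank 0), $\chi_{\mathsf{M}}(t)=\sum_{F}\mu_{\mathsf{M}|_F}t^{\mathrm{rk}(\mathsf{M}/F)}$; the inverse Kazhdan–Lusztig polynomial $Q_{\mathsf{M}}(t)$ is the unique assignment with $Q_{\mathsf{M}}=1$ in rank 0, $\deg Q_{\mathsf{M}}<\mathrm{rk}(\mathsf{M})/2$ in positive rank, and $(-t)^{\mathrm{rk}(\mathsf{M})}Q_{\mathsf{M}}(t^{-1})=\sum_{F\in\mathcal{L}(\mathsf{M})}(-1)^{\mathrm{rk}(F)}Q_{\mathsf{M}|_F}(t)t^{\mathrm{rk}(\mathsf{M}/F)}\chi_{\mathsf{M}/F}(t^{-1})$. The inverse $Z$-polynomial of loopless $\mathsf{M}$ is $Y_{\mathsf{M}}(t)=(-1)^{\mathrm{rk}(\mathsf{M})}\sum_{F\in\mathcal{L}(\mathsf{M})}(-1)^{\mathrm{rk}(F)}Q_{\mathsf{M}|_F}(t)t^{\mathrm{rk}(\mathsf{M}/F)}\mu_{\mathsf{M}/F}$;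 for $\mathsf{M}$ with loops, $Y_{\mathsf{M}}:=Y$ of $\mathsf{M}$ with loops deleted. Writing $Y_{\mathsf{M}}(t)=\sum_{i=0}^k a_it^i$: unimodal means $a_0\le\cdots\le a_j\ge a_{j+1}\ge\cdots\ge a_k$ for some $j$; log-concave means $a_i^2\ge a_{i-1}a_{i+1}$ for $0<i<k$; no internal zeros means there are no $i<j<l$ with $a_i,a_l\neq0$ and $a_j=0$. *)

theory Defs
  imports "HOL-Computational_Algebra.Polynomial"
begin

section \<open>Finite matroids\<close>

record 'a matroid =
  ground :: "'a set"
  indep :: "'a set set"

definition is_matroid :: "'a matroid \<Rightarrow> bool" where
  "is_matroid M \<longleftrightarrow>
     finite (ground M) \<and>
     indep M \<subseteq> Pow (ground M) \<and>
     {} \<in> indep M \<and>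
     (\<forall>I\<in>indep M. \<forall>J. J \<subseteq> I \<longrightarrow> J \<in> indep M) \<and>
     (\<forall>I\<in>indep M. \<forall>J\<in>indep M. card I < card J \<longrightarrow> (\<exists>x\<in>J - I. insert x I \<in> indep M))"

definition rank_of :: "'a matroid \<Rightarrow> 'a set \<Rightarrow> nat" where
  "rank_of M X = Max (card ` {I \<in> indep M. I \<subseteq> X})"

definition rk :: "'a matroid \<Rightarrow> nat" where
  "rk M = rank_of M (ground M)"

definition circuits :: "'a matroid \<Rightarrow> 'a set set" where
  "circuits M = {C. C \<subseteq> ground M \<and> C \<notin> indep M \<and> (\<forall>D. D \<subset> C \<longrightarrow> D \<in> indep M)}"

definition bases :: "'a matroid \<Rightarrow> 'a set set" where
  "bases M = {B \<in> indep M. \<forall>I\<in>indep M. B \<subseteq> I \<longrightarrow> I = B}"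

definition flats :: "'a matroid \<Rightarrow> 'a set set" where
  "flats M = {F. F \<subseteq> ground M \<and> (\<forall>x\<in>ground M - F. rank_of M F < rank_of M (insert x F))}"

definition loops :: "'a matroid \<Rightarrow> 'a set" where
  "loops M = {x \<in> ground M. {x} \<notin> indep M}"

definition loopless :: "'a matroid \<Rightarrow> bool" where
  "loopless M \<longleftrightarrow> loops M = {}"

definition restriction :: "'a matroid \<Rightarrow> 'a set \<Rightarrow> 'a matroid" where
  "restriction M F = \<lparr>ground = F, indep = {I \<in> indep M. I \<subseteq> F}\<rparr>"

definition contraction :: "'a matroid \<Rightarrow> 'a set \<Rightarrow> 'a matroid" where
  "contraction M F =
     \<lparr>ground = ground M - F,
      indep = {I. I \<subseteq> ground M - F \<and> rank_of M (I \<union> F) = card I + rank_of M F}\<rparr>"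

definition deletion :: "'a matroid \<Rightarrow> 'a set \<Rightarrow> 'a matroid" where
  "deletion M X = restriction M (ground M - X)"

definition dual :: "'a matroid \<Rightarrow> 'a matroid" where
  "dual M = \<lparr>ground = ground M, indep = {I. \<exists>B\<in>bases M. I \<subseteq> ground M - B}\<rparr>"

definition paving :: "'a matroid \<Rightarrow> bool" where
  "paving M \<longleftrightarrow> (\<forall>C\<in>circuits M. rk M \<le> card C)"

definition sparse_paving :: "'a matroid \<Rightarrow> bool" where
  "sparse_paving M \<longleftrightarrow> paving M \<and> paving (dual M)"


section \<open>Moebius function and characteristic polynomial\<close>

text \<open>
  Moebius function of a family \<open>L\<close> of sets ordered by inclusion. The conjunct
  \<open>finite Y\<close> is there for termination only.
\<close>
function moebius :: "'a set set \<Rightarrow> 'a set \<Rightarrow> 'a set \<Rightarrow> int" where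
  "moebius L X Y =
     (if X = Y then 1
      else if X \<subset> Y \<and> finite Y then - (\<Sum>Z | Z \<in> L \<and> X \<subseteq> Z \<and> Z \<subset> Y. moebius L X Z)
      else 0)"
  by pat_completeness auto
termination
  by (relation "measure (\<lambda>(L, X, Y). card Y)") (auto intro: psubset_card_mono)

declare moebius.simps [simp del]

definition mu :: "'a matroid \<Rightarrow> int" where
  "mu M = moebius (flats M) {} (ground M)"

definition chi :: "'a matroid \<Rightarrow> int poly" where
  "chi M = (\<Sum>F\<in>flats M. monom (mu (restriction M F)) (rk (contraction M F)))"


section \<open>Inverse Kazhdan--Lusztig polynomial and inverse Z-polynomial\<close>

text \<open>\<open>recip d p\<close> is the polynomial \<open>t\<^sup>d p(1/t)\<close>, for \<open>p\<close> of degree at most \<open>d\<close>.\<close>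
definition recip :: "nat \<Rightarrow> 'a::comm_ring_1 poly \<Rightarrow> 'a poly" where
  "recip d p = (\<Sum>i\<le>d. monom (coeff p i) (d - i))"

lemma poly_recip:
  fixes p :: "'a::field poly"
  assumes "degree p \<le> d" "t \<noteq> 0"
  shows "poly (recip d p) t = t ^ d * poly p (inverse t)"
proof -
  have "poly p (inverse t) = (\<Sum>i\<le>d. coeff p i * inverse t ^ i)"
    unfolding poly_altdef using assms(1)
    by (intro sum.mono_neutral_left) (auto simp: coeff_eq_0)
  moreover have "t ^ (d - i) = t ^ d * inverse t ^ i" if "i \<le> d" for i
    using that assms(2) by (simp add: power_diff power_inverse field_simps)
  ultimately show ?thesis
    by (simp add: recip_def poly_sum poly_monom sum_distrib_left mult_ac)
qed

text \<open>
  The defining conditions on the assignment \<open>M \<mapsto> Q\<^sub>M\<close>. The last clause only fixes the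
  irrelevant values, so that the assignment is unique as a total function.
\<close>
definition is_inverse_KL :: "('a matroid \<Rightarrow> int poly) \<Rightarrow> bool" where
  "is_inverse_KL Q \<longleftrightarrow>
     (\<forall>M. is_matroid M \<and> loopless M \<longrightarrow>
        (rk M = 0 \<longrightarrow> Q M = 1) \<and>
        (rk M > 0 \<longrightarrow> 2 * degree (Q M) < rk M) \<and>
        (-1) ^ rk M * recip (rk M) (Q M) =
          (\<Sum>F\<in>flats M. (-1) ^ rank_of M F * Q (restriction M F) *
             recip (rk (contraction M F)) (chi (contraction M F)))) \<and>
     (\<forall>M. \<not> (is_matroid M \<and> loopless M) \<longrightarrow> Q M = 0)"

definition inverse_KL :: "'a matroid \<Rightarrow> int poly" where
  "inverse_KL = (THE Q. is_inverse_KL Q)"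

definition inverse_Z_loopless :: "'a matroid \<Rightarrow> int poly" where
  "inverse_Z_loopless M =
     (-1) ^ rk M * (\<Sum>F\<in>flats M. (-1) ^ rank_of M F * inverse_KL (restriction M F) *
        monom (mu (contraction M F)) (rk (contraction M F)))"

definition inverse_Z :: "'a matroid \<Rightarrow> int poly" where
  "inverse_Z M = inverse_Z_loopless (deletion M (loops M))"


section \<open>Properties of finite sequences $a_0, \dots, a_k$\<close>

definition unimodal :: "nat \<Rightarrow> (nat \<Rightarrow> int) \<Rightarrow> bool" where
  "unimodal k a \<longleftrightarrow>
     (\<exists>j\<le>k. (\<forall>i<j. a i \<le> a (Suc i)) \<and> (\<forall>i. j \<le> i \<and> i < k \<longrightarrow> a (Suc i) \<le> a i))"

definition log_concave :: "nat \<Rightarrow> (nat \<Rightarrow> int) \<Rightarrow> bool" where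
  "log_concave k a \<longleftrightarrow> (\<forall>i. 0 < i \<and> i < k \<longrightarrow> a (i - 1) * a (i + 1) \<le> (a i)\<^sup>2)"

definition no_internal_zeros :: "nat \<Rightarrow> (nat \<Rightarrow> int) \<Rightarrow> bool" where
  "no_internal_zeros k a \<longleftrightarrow>
     \<not> (\<exists>i j l. i < j \<and> j < l \<and> l \<le> k \<and> a i \<noteq> 0 \<and> a l \<noteq> 0 \<and> a j = 0)"

end

theory Submission
  imports Defs Complex_Main
begin

text \<open>
  Moebius inversion turns the recursion that defines \<open>Q\<close> into the statement that \<open>Y\<^sub>M\<close> is
  palindromic of degree \<open>rk M\<close> for every loopless \<open>M\<close>. This gives existence and uniqueness of
  \<open>Q\<close>: the terms of \<open>Y\<^sub>M\<close> other than \<open>Q\<^sub>M\<close> are known by induction, and exactly one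
  polynomial of degree below \<open>rk M / 2\<close> makes the sum palindromic.

  Ranks at most 1 are trivial. A sparse paving matroid of rank \<open>k \<ge> 2\<close> is given by its set of
  circuit-hyperplanes, \<open>l\<close> many, any two of which meet in at most \<open>k - 2\<close> points. Its proper
  flats restrict to Boolean matroids, with \<open>Q = 1\<close>, or to \<open>U\<^bsub>k-1,k\<^esub>\<close>, and the Moebius
  function gives \<open>a\<^sub>j = (k choose j) f(j)\<close> for \<open>j < k/2\<close>, where
  \<open>f(j) = N (k - j) / (n - j) - l\<close> and \<open>N = (n choose k)\<close>. Since \<open>f\<close> is positive and concave,
  this part is log-concave; near the middle one uses \<open>l (k + 1) \<le> N\<close> and
  \<open>l (n - k + 1) \<le> N\<close>, which hold because every \<open>(k-1)\<close>-set lies in, and every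
  \<open>(k+1)\<close>-set contains, at most one circuit-hyperplane. For \<open>k = 2m\<close> the middle coefficient
  also receives the top coefficient of \<open>Q\<close> of \<open>U\<^bsub>k-1,k\<^esub>\<close>, a Catalan number, for each
  circuit-hyperplane.
\<close>

section \<open>Rank, restriction and contraction\<close>

lemma recip_coeff: "coeff (recip d p) i = (if i \<le> d then coeff p (d - i) else 0)"
proof -
  have "coeff (recip d p) i = (\<Sum>j\<le>d. if d - i = j \<and> i \<le> d then coeff p j else 0)"
    unfolding recip_def coeff_sum coeff_monom by (intro sum.cong) auto
  then show ?thesis by (auto simp: sum.delta)
qed

lemma matroid_finite: "is_matroid M \<Longrightarrow> finite (ground M)"
  and indep_subset_ground: "is_matroid M \<Longrightarrow> I \<in> indep M \<Longrightarrow> I \<subseteq> ground M"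
  and indep_empty: "is_matroid M \<Longrightarrow> {} \<in> indep M"
  and indep_subset: "is_matroid M \<Longrightarrow> I \<in> indep M \<Longrightarrow> J \<subseteq> I \<Longrightarrow> J \<in> indep M"
  and indep_augment: "is_matroid M \<Longrightarrow> I \<in> indep M \<Longrightarrow> J \<in> indep M \<Longrightarrow> card I < card J \<Longrightarrow>
    \<exists>x\<in>J - I. insert x I \<in> indep M"
  unfolding is_matroid_def by blast+

lemma indep_finite: "is_matroid M \<Longrightarrow> I \<in> indep M \<Longrightarrow> finite I"
  using matroid_finite indep_subset_ground finite_subset by metis

lemma finite_indep: "is_matroid M \<Longrightarrow> finite (indep M)"
  unfolding is_matroid_def using finite_subset[of "indep M" "Pow (ground M)"] by auto

lemma indep_card_le_rank:
  assumes "is_matroid M" "I \<in> indep M" "I \<subseteq> X"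
  shows "card I \<le> rank_of M X"
  unfolding rank_of_def using finite_indep[OF assms(1)] assms(2,3) by (intro Max_ge) auto

lemma rank_attained:
  assumes "is_matroid M"
  obtains I where "I \<in> indep M" "I \<subseteq> X" "card I = rank_of M X"
proof -
  have "rank_of M X \<in> card ` {I \<in> indep M. I \<subseteq> X}"
    unfolding rank_of_def using finite_indep[OF assms] indep_empty[OF assms] by (intro Max_in) auto
  then show ?thesis using that by auto
qed

lemma rank_le:
  assumes "is_matroid M" "\<And>I. I \<in> indep M \<Longrightarrow> I \<subseteq> X \<Longrightarrow> card I \<le> b"
  shows "rank_of M X \<le> b"
  using rank_attained[OF assms(1), of X] assms(2) by metis

lemma rank_mono:
  assumes "is_matroid M" "X \<subseteq> Y"
  shows "rank_of M X \<le> rank_of M Y"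
  using rank_attained[OF assms(1), of X] indep_card_le_rank[OF assms(1)] assms(2)
  by (metis subset_trans)

lemma rank_le_card:
  assumes "is_matroid M" "finite X"
  shows "rank_of M X \<le> card X"
  using assms by (intro rank_le) (auto intro: card_mono)

lemma rank_indep:
  assumes "is_matroid M" "I \<in> indep M"
  shows "rank_of M I = card I"
  using indep_card_le_rank[OF assms subset_refl] rank_le_card[OF assms(1) indep_finite[OF assms]]
  by simp

lemma indep_extend:
  assumes M: "is_matroid M" and "I \<in> indep M" "I \<subseteq> X"
  obtains J where "J \<in> indep M" "I \<subseteq> J" "J \<subseteq> X" "card J = rank_of M X"
proof -
  have "\<exists>J. J \<in> indep M \<and> I \<subseteq> J \<and> J \<subseteq> X \<and> card J = rank_of M X"
    using assms(2,3)
  proof (induction "rank_of M X - card I" arbitrary: I rule: less_induct)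
    case less
    show ?case
    proof (cases "card I = rank_of M X")
      case True
      then show ?thesis using less.prems by auto
    next
      case False
      with indep_card_le_rank[OF M less.prems] have lt: "card I < rank_of M X" by simp
      obtain B where B: "B \<in> indep M" "B \<subseteq> X" "card B = rank_of M X"
        using rank_attained[OF M] .
      obtain x where x: "x \<in> B - I" "insert x I \<in> indep M"
        using indep_augment[OF M less.prems(1) B(1)] lt B(3) by auto
      have "card (insert x I) = Suc (card I)"
        using x(1) indep_finite[OF M less.prems(1)] by auto
      then have "rank_of M X - card (insert x I) < rank_of M X - card I" using lt by simp
      moreover have "insert x I \<subseteq> X" using x B less.prems by auto
      ultimately show ?thesis
        using less.hyps[of "insert x I"] x(2) by blast
    qed
  qed
  then show ?thesis using that by blast
qed

lemma flats_subset: "F \<in> flats M \<Longrightarrow> F \<subseteq> ground M"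
  by (simp add: flats_def)

lemma ground_in_flats: "ground M \<in> flats M"
  by (simp add: flats_def)

lemma finite_flats: "is_matroid M \<Longrightarrow> finite (flats M)"
  by (rule finite_subset[of "flats M" "Pow (ground M)"]) (auto simp: flats_def matroid_finite)

lemma ground_restriction [simp]: "ground (restriction M F) = F"
  by (simp add: restriction_def)

lemma ground_contraction [simp]: "ground (contraction M F) = ground M - F"
  by (simp add: contraction_def)

lemma restriction_ground: "is_matroid M \<Longrightarrow> restriction M (ground M) = M"
  using indep_subset_ground[of M] by (cases M) (auto simp: restriction_def)

lemma restriction_restriction:
  "G \<subseteq> F \<Longrightarrow> restriction (restriction M F) G = restriction M G"
  by (auto simp: restriction_def)

lemma matroid_restriction:
  assumes "is_matroid M" "F \<subseteq> ground M"
  shows "is_matroid (restriction M F)"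
  unfolding is_matroid_def
proof (intro conjI ballI allI impI)
  show "finite (ground (restriction M F))"
    using assms matroid_finite finite_subset by fastforce
next
  fix I J assume IJ: "I \<in> indep (restriction M F)" "J \<in> indep (restriction M F)" "card I < card J"
  then obtain x where "x \<in> J - I" "insert x I \<in> indep M"
    using indep_augment[OF assms(1), of I J] by (auto simp: restriction_def)
  then show "\<exists>x\<in>J - I. insert x I \<in> indep (restriction M F)"
    using IJ by (auto simp: restriction_def)
qed (use assms in \<open>auto simp: restriction_def indep_empty intro: indep_subset\<close>)

lemma rank_restriction: "X \<subseteq> F \<Longrightarrow> rank_of (restriction M F) X = rank_of M X"
  unfolding rank_of_def restriction_def by (rule arg_cong[where f = Max]) auto

lemma rk_restriction: "rk (restriction M F) = rank_of M F"
  by (simp add: rk_def rank_restriction)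

lemma loopless_restriction:
  "loopless M \<Longrightarrow> F \<subseteq> ground M \<Longrightarrow> loopless (restriction M F)"
  by (auto simp: loopless_def loops_def restriction_def)

text \<open>Only elements x outside K need an argument. A basis of G is extended to a basis of K and
  then to one of \<open>insert x K\<close>; since K is a flat, the last extension must pick up x, so
  x raises the rank of G as well.\<close>

lemma flats_restriction:
  assumes M: "is_matroid M" and K: "K \<in> flats M"
  shows "flats (restriction M K) = {G \<in> flats M. G \<subseteq> K}"
proof (intro equalityI subsetI)
  fix G assume G: "G \<in> flats (restriction M K)"
  then have GK: "G \<subseteq> K" by (simp add: flats_def)
  have "rank_of M G < rank_of M (insert x G)" if x: "x \<in> ground M - G" for x
  proof (cases "x \<in> K")
    case True
    then have "rank_of (restriction M K) G < rank_of (restriction M K) (insert x G)"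
      using G x by (simp add: flats_def)
    then show ?thesis using True GK by (simp add: rank_restriction)
  next
    case False
    obtain I where I: "I \<in> indep M" "I \<subseteq> G" "card I = rank_of M G"
      using rank_attained[OF M] .
    obtain J where J: "J \<in> indep M" "I \<subseteq> J" "J \<subseteq> K" "card J = rank_of M K"
      using indep_extend[OF M I(1), of K] I(2) GK by blast
    obtain J' where J': "J' \<in> indep M" "J \<subseteq> J'" "J' \<subseteq> insert x K" "card J' = rank_of M (insert x K)"
      using indep_extend[OF M J(1), of "insert x K"] J(3) by blast
    have "rank_of M K < rank_of M (insert x K)"
      using K x False by (simp add: flats_def)
    then have "\<not> J' \<subseteq> K"
      using indep_card_le_rank[OF M J'(1), of K] J'(4) by linarith
    then have "insert x I \<subseteq> J'" using J' J by auto
    then have "insert x I \<in> indep M" using indep_subset[OF M J'(1)] by blast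
    then have "card (insert x I) \<le> rank_of M (insert x G)"
      using I by (intro indep_card_le_rank[OF M]) auto
    then show ?thesis
      using I x indep_finite[OF M I(1)] by (simp add: card_insert_if subset_iff split: if_splits)
  qed
  then show "G \<in> {G \<in> flats M. G \<subseteq> K}"
    using GK flats_subset[OF K] by (auto simp: flats_def)
next
  fix G assume "G \<in> {G \<in> flats M. G \<subseteq> K}"
  then show "G \<in> flats (restriction M K)"
    using flats_subset[OF K] by (auto simp: flats_def rank_restriction subset_iff)
qed

text \<open>Monotonicity of the rank gives the upper bound. It is attained by \<open>K - F\<close>,
  where K is a basis of the union of X and F that extends a basis of F: such a K meets F in exactly
  \<open>rank_of M F\<close> elements.\<close>

lemma rank_contraction:
  assumes M: "is_matroid M" and F: "F \<subseteq> ground M" and X: "X \<subseteq> ground M - F"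
  shows "rank_of (contraction M F) X = rank_of M (X \<union> F) - rank_of M F"
proof -
  let ?S = "{I \<in> indep (contraction M F). I \<subseteq> X}"
  have S: "?S = {I. I \<subseteq> X \<and> rank_of M (I \<union> F) = card I + rank_of M F}"
    using X by (auto simp: contraction_def)
  have fin: "finite ?S"
    unfolding S using X matroid_finite[OF M]
    by (auto intro!: finite_subset[of _ "Pow (ground M)"])
  show ?thesis unfolding rank_of_def[of "contraction M F"]
  proof (rule Max_eqI)
    show "finite (card ` ?S)" using fin by blast
  next
    fix y assume "y \<in> card ` ?S"
    then obtain I where I: "I \<subseteq> X" "rank_of M (I \<union> F) = card I + rank_of M F" "y = card I"
      unfolding S by auto
    have "rank_of M (I \<union> F) \<le> rank_of M (X \<union> F)" using I by (intro rank_mono[OF M]) auto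
    then show "y \<le> rank_of M (X \<union> F) - rank_of M F" using I by linarith
  next
    obtain J where J: "J \<in> indep M" "J \<subseteq> F" "card J = rank_of M F"
      using rank_attained[OF M] .
    obtain K where K: "K \<in> indep M" "J \<subseteq> K" "K \<subseteq> X \<union> F" "card K = rank_of M (X \<union> F)"
      using indep_extend[OF M J(1), of "X \<union> F"] J(2) by blast
    have fK: "finite K" by (rule indep_finite[OF M K(1)])
    have "card (K \<inter> F) \<le> rank_of M F"
      by (intro indep_card_le_rank[OF M] indep_subset[OF M K(1)]) auto
    moreover have "card J \<le> card (K \<inter> F)" using fK J K by (intro card_mono) auto
    ultimately have c: "card (K \<inter> F) = rank_of M F" using J by linarith
    have c2: "card K = card (K - F) + card (K \<inter> F)"
      using fK by (metis Diff_disjoint Int_Diff_Un Int_Diff_disjoint card_Un_disjoint finite_Diff finite_Int add.commute)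
    have "rank_of M (K - F \<union> F) \<le> rank_of M (X \<union> F)"
      using K by (intro rank_mono[OF M]) auto
    moreover have "card K \<le> rank_of M (K - F \<union> F)"
      by (rule indep_card_le_rank[OF M K(1)]) auto
    ultimately have "rank_of M (K - F \<union> F) = card (K - F) + rank_of M F"
      using c c2 K(4) by linarith
    then have "K - F \<in> ?S" unfolding S using K X by auto
    moreover have "rank_of M (X \<union> F) - rank_of M F = card (K - F)"
      using c c2 K(4) by linarith
    ultimately show "rank_of M (X \<union> F) - rank_of M F \<in> card ` ?S" by blast
  qed
qed

lemma rk_contraction:
  assumes "is_matroid M" "F \<subseteq> ground M"
  shows "rk (contraction M F) = rk M - rank_of M F"
  using rank_contraction[OF assms, of "ground M - F"] assms(2)
  by (simp add: rk_def Un_absorb2)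

lemma flats_contraction:
  assumes M: "is_matroid M" and F: "F \<subseteq> ground M"
  shows "flats (contraction M F) = (\<lambda>G. G - F) ` {G \<in> flats M. F \<subseteq> G}"
proof -
  have *: "X \<in> flats (contraction M F) \<longleftrightarrow> X \<union> F \<in> flats M" if X: "X \<subseteq> ground M - F" for X
  proof -
    have "rank_of (contraction M F) X < rank_of (contraction M F) (insert x X) \<longleftrightarrow>
        rank_of M (X \<union> F) < rank_of M (insert x (X \<union> F))" if "x \<in> ground M - F - X" for x
    proof -
      \<comment> \<open>The subtractions in \<open>rank_contraction\<close> therefore do not
        truncate, and strict inequalities carry over.\<close>
      have "rank_of M F \<le> rank_of M (X \<union> F)" by (rule rank_mono[OF M]) auto
      then show ?thesis
        using rank_contraction[OF M F X] rank_contraction[OF M F, of "insert x X"] that X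
        by (auto simp: less_diff_iff)
    qed
    then show ?thesis using X F by (auto simp: flats_def)
  qed
  show ?thesis
  proof (intro equalityI subsetI)
    fix X assume X: "X \<in> flats (contraction M F)"
    then have "X \<subseteq> ground M - F" by (simp add: flats_def)
    then show "X \<in> (\<lambda>G. G - F) ` {G \<in> flats M. F \<subseteq> G}"
      using *[of X] X by (intro image_eqI[of _ _ "X \<union> F"]) auto
  next
    fix X assume "X \<in> (\<lambda>G. G - F) ` {G \<in> flats M. F \<subseteq> G}"
    then obtain G where G: "G \<in> flats M" "F \<subseteq> G" "X = G - F" by auto
    then have "X \<subseteq> ground M - F" "X \<union> F = G" using flats_subset by auto
    then show "X \<in> flats (contraction M F)" using * G by simp
  qed
qed

lemma restriction_contraction:
  assumes "F \<subseteq> G" "G \<subseteq> ground M"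
  shows "restriction (contraction M F) (G - F) = contraction (restriction M G) F"
proof -
  have "rank_of (restriction M G) (I \<union> F) = rank_of M (I \<union> F)" if "I \<subseteq> G - F" for I
    using that assms by (intro rank_restriction) auto
  moreover have "rank_of (restriction M G) F = rank_of M F"
    using assms by (intro rank_restriction) auto
  ultimately show ?thesis
    using assms unfolding restriction_def[of "contraction M F"] unfolding contraction_def by auto
qed

lemma contraction_contraction:
  assumes M: "is_matroid M" and "F \<subseteq> G" "G \<subseteq> ground M"
  shows "contraction (contraction M F) (G - F) = contraction M G"
proof -
  have F: "F \<subseteq> ground M" using assms by auto
  have G: "G - F \<union> F = G" using assms by auto
  have le: "rank_of M F \<le> rank_of M G" "\<And>I. rank_of M F \<le> rank_of M (I \<union> G)"
    using assms(2) by (auto intro!: rank_mono[OF M])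
  have eq: "rank_of (contraction M F) (I \<union> (G - F)) = rank_of M (I \<union> G) - rank_of M F"
    if "I \<subseteq> ground M - G" for I
  proof -
    have "I \<union> (G - F) \<union> F = I \<union> G" using assms by auto
    then show ?thesis using rank_contraction[OF M F, of "I \<union> (G - F)"] that assms by auto
  qed
  have "rank_of (contraction M F) (G - F) = rank_of M G - rank_of M F"
    using rank_contraction[OF M F, of "G - F"] assms by (simp add: G Diff_mono del: Un_Diff_cancel2)
  moreover have "a - c = m + (b - c) \<longleftrightarrow> a = m + b" if "c \<le> a" "c \<le> b" for a b c m :: nat
    using that by linarith
  moreover have "ground M - F - (G - F) = ground M - G" using assms by auto
  ultimately show ?thesis
    using eq le unfolding contraction_def[of "contraction M F"] contraction_def[of M G] by auto
qed

section \<open>Moebius function of the lattice of flats, its restrictions and contractions\<close>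

lemma moebius_refl [simp]: "moebius L X X = 1"
  by (simp add: moebius.simps)

lemma moebius_rec:
  assumes "X \<subset> Y" "finite Y"
  shows "moebius L X Y = - (\<Sum>Z | Z \<in> L \<and> X \<subseteq> Z \<and> Z \<subset> Y. moebius L X Z)"
  using assms by (subst moebius.simps) auto

text \<open>The recursion with its top term moved to the other side. This is the Kronecker delta
  that collapses swapped sums over flats.\<close>

lemma moebius_sum:
  assumes "finite Y" "X \<subseteq> Y" "Y \<in> L"
  shows "(\<Sum>Z | Z \<in> L \<and> X \<subseteq> Z \<and> Z \<subseteq> Y. moebius L X Z) = (if X = Y then 1 else 0)"
proof -
  have "{Z \<in> L. X \<subseteq> Z \<and> Z \<subseteq> Y} = insert Y {Z \<in> L. X \<subseteq> Z \<and> Z \<subset> Y}"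
    using assms by auto
  moreover have "finite {Z \<in> L. X \<subseteq> Z \<and> Z \<subset> Y}"
    using assms(1) by (auto intro: finite_subset[of _ "Pow Y"])
  ultimately have "(\<Sum>Z | Z \<in> L \<and> X \<subseteq> Z \<and> Z \<subseteq> Y. moebius L X Z) =
      moebius L X Y + (\<Sum>Z | Z \<in> L \<and> X \<subseteq> Z \<and> Z \<subset> Y. moebius L X Z)"
    by simp
  moreover have "(\<Sum>Z | Z \<in> L \<and> X \<subseteq> Z \<and> Z \<subset> Y. moebius L X Z) = 0" if "X = Y"
    using that by (intro sum.neutral) auto
  ultimately show ?thesis using moebius_rec[of X Y L] assms by (cases "X = Y") auto
qed

text \<open>Subtracting F is an isomorphism from the interval [F, Y] onto [{}, Y - F]. It lets
  Moebius values of a contraction be computed among the flats of M itself.\<close>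

lemma moebius_Diff:
  assumes "finite Y" "F \<subseteq> Y"
    and "\<And>Z. F \<subseteq> Z \<Longrightarrow> Z \<subseteq> Y \<Longrightarrow> Z - F \<in> L' \<longleftrightarrow> Z \<in> L"
  shows "moebius L' {} (Y - F) = moebius L F Y"
  using assms
proof (induction "card Y" arbitrary: Y rule: less_induct)
  case less
  show ?case
  proof (cases "F = Y")
    case False
    then have ps: "F \<subset> Y" "{} \<subset> Y - F" using less.prems by auto
    have fin: "finite (Y - F)" using less.prems by simp
    have "(\<Sum>Z | Z \<in> L' \<and> {} \<subseteq> Z \<and> Z \<subset> Y - F. moebius L' {} Z) =
        (\<Sum>Z | Z \<in> L \<and> F \<subseteq> Z \<and> Z \<subset> Y. moebius L F Z)"
    proof (rule sum.reindex_bij_witness[where i = "\<lambda>Z. Z - F" and j = "\<lambda>Z. Z \<union> F"])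
      fix Z assume Z: "Z \<in> {Z \<in> L'. {} \<subseteq> Z \<and> Z \<subset> Y - F}"
      then have d: "Z \<union> F - F = Z" "Z \<union> F \<subset> Y" using less.prems(2) by auto
      then show "Z \<union> F - F = Z" "Z \<union> F \<in> {Z \<in> L. F \<subseteq> Z \<and> Z \<subset> Y}"
        using Z less.prems(3)[of "Z \<union> F"] by auto
      have "moebius L' {} (Z \<union> F - F) = moebius L F (Z \<union> F)"
        using d less.prems by (intro less.hyps psubset_card_mono) (auto intro: finite_subset)
      then show "moebius L F (Z \<union> F) = moebius L' {} Z" using d by simp
    next
      fix Z assume Z: "Z \<in> {Z \<in> L. F \<subseteq> Z \<and> Z \<subset> Y}"
      then show "Z - F \<union> F = Z" by auto
      show "Z - F \<in> {Z \<in> L'. {} \<subseteq> Z \<and> Z \<subset> Y - F}"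
        using Z less.prems(3)[of Z] by auto
    qed
    then show ?thesis
      using moebius_rec[OF ps(1) less.prems(1), of L] moebius_rec[OF ps(2) fin, of L'] by simp
  qed simp
qed

text \<open>The recursion only visits members of the family below the upper end, which is why
  passing to a restriction leaves the value unchanged.\<close>

lemma moebius_cong:
  assumes "finite Y" "\<And>Z. Z \<subseteq> Y \<Longrightarrow> Z \<in> L' \<longleftrightarrow> Z \<in> L"
  shows "moebius L' X Y = moebius L X Y"
  using assms
proof (induction "card Y" arbitrary: Y rule: less_induct)
  case less
  show ?case
  proof (cases "X \<subset> Y")
    case True
    have "{Z \<in> L'. X \<subseteq> Z \<and> Z \<subset> Y} = {Z \<in> L. X \<subseteq> Z \<and> Z \<subset> Y}"
      using less.prems by blast
    moreover have "moebius L' X Z = moebius L X Z" if "Z \<subset> Y" for Z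
      using that less.prems by (intro less.hyps psubset_card_mono) (auto intro: finite_subset)
    ultimately show ?thesis
      by (simp only: moebius_rec[OF True less.prems(1)]) (intro arg_cong[where f = uminus] sum.cong; simp)
  next
    case False
    then show ?thesis by (auto simp: moebius.simps)
  qed
qed

lemma mu_contraction:
  assumes M: "is_matroid M" and F: "F \<subseteq> ground M"
  shows "mu (contraction M F) = moebius (flats M) F (ground M)"
  unfolding mu_def ground_contraction
proof (rule moebius_Diff[OF matroid_finite[OF M] F])
  fix Z assume Z: "F \<subseteq> Z" "Z \<subseteq> ground M"
  have "G = Z" if "F \<subseteq> G" "G - F = Z - F" for G using that Z by auto
  then show "Z - F \<in> flats (contraction M F) \<longleftrightarrow> Z \<in> flats M"
    unfolding flats_contraction[OF M F] using Z by auto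
qed

lemma mu_restriction_contraction:
  assumes M: "is_matroid M" and G: "G \<in> flats M" and F: "F \<subseteq> G"
  shows "mu (restriction (contraction M F) (G - F)) = moebius (flats M) F G"
proof -
  have sub: "G \<subseteq> ground M" by (rule flats_subset[OF G])
  have "mu (restriction (contraction M F) (G - F)) = moebius (flats (restriction M G)) F G"
    using mu_contraction[OF matroid_restriction[OF M sub], of F] F
    by (simp add: restriction_contraction[OF F sub])
  also have "\<dots> = moebius (flats M) F G"
    by (rule moebius_cong[OF finite_subset[OF sub matroid_finite[OF M]]])
      (simp add: flats_restriction[OF M G])
  finally show ?thesis .
qed

lemma chi_contraction:
  assumes M: "is_matroid M" and F: "F \<subseteq> ground M"
  shows "chi (contraction M F) =
    (\<Sum>G | G \<in> flats M \<and> F \<subseteq> G. monom (moebius (flats M) F G) (rk M - rank_of M G))"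
proof -
  have inj: "inj_on (\<lambda>G. G - F) {G \<in> flats M. F \<subseteq> G}"
    by (auto simp: inj_on_def)
  show ?thesis
    unfolding chi_def flats_contraction[OF M F] sum.reindex[OF inj] o_def
    by (intro sum.cong refl)
      (auto simp: mu_restriction_contraction[OF M] contraction_contraction[OF M]
        rk_contraction[OF M] flats_subset)
qed

lemma rank_le_rk:
  assumes "is_matroid M" "F \<in> flats M"
  shows "rank_of M F \<le> rk M"
  unfolding rk_def using assms by (intro rank_mono flats_subset)

lemma recip_chi_contraction:
  assumes M: "is_matroid M" and F: "F \<in> flats M"
  shows "recip (rk (contraction M F)) (chi (contraction M F)) =
    (\<Sum>G | G \<in> flats M \<and> F \<subseteq> G. monom (moebius (flats M) F G) (rank_of M G - rank_of M F))"
proof (rule poly_eqI)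
  fix i
  have sub: "F \<subseteq> ground M" by (rule flats_subset[OF F])
  \<comment> \<open>Reversal in degree \<open>rk M - rank_of M F\<close> sends the exponent
    \<open>rk M - rank_of M G\<close> to \<open>rank_of M G - rank_of M F\<close>; monotonicity of
    the rank keeps all subtractions exact.\<close>
  have *: "(i \<le> rk M - rank_of M F \<and> rk M - rank_of M G = rk M - rank_of M F - i) \<longleftrightarrow>
      rank_of M G - rank_of M F = i" if "G \<in> flats M" "F \<subseteq> G" for G
    using rank_mono[OF M that(2)] rank_le_rk[OF M that(1)] by linarith
  have "coeff (recip (rk (contraction M F)) (chi (contraction M F))) i =
    (\<Sum>G | G \<in> flats M \<and> F \<subseteq> G. if i \<le> rk M - rank_of M F \<and>
        rk M - rank_of M G = rk M - rank_of M F - i then moebius (flats M) F G else 0)"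
    by (auto simp: recip_coeff chi_contraction[OF M sub] rk_contraction[OF M sub] coeff_sum
        intro!: sum.cong)
  also have "\<dots> = coeff (\<Sum>G | G \<in> flats M \<and> F \<subseteq> G.
      monom (moebius (flats M) F G) (rank_of M G - rank_of M F)) i"
    unfolding coeff_sum coeff_monom using * by (intro sum.cong) auto
  finally show "coeff (recip (rk (contraction M F)) (chi (contraction M F))) i = \<dots>" .
qed

section \<open>Existence and uniqueness of the inverse Kazhdan--Lusztig polynomial\<close>

definition yterm :: "('a matroid \<Rightarrow> int poly) \<Rightarrow> 'a matroid \<Rightarrow> 'a set \<Rightarrow> int poly" where
  "yterm Q M F = (-1) ^ rank_of M F * Q (restriction M F) *
     monom (mu (contraction M F)) (rk (contraction M F))"

text \<open>Up to the sign \<open>(-1)\<^bsup>rk M\<^esup>\<close>, \<open>ysum Q M\<close> is the inverse \<open>Z\<close>-polynomial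
  that belongs to the assignment \<open>Q\<close>.\<close>
definition ysum :: "('a matroid \<Rightarrow> int poly) \<Rightarrow> 'a matroid \<Rightarrow> int poly" where
  "ysum Q M = (\<Sum>F\<in>flats M. yterm Q M F)"

text \<open>The clauses of \<open>is_inverse_KL\<close> that precede the recursion, split off so
  that the recursion and palindromicity can be compared for any assignment satisfying them.\<close>

definition admissible :: "('a matroid \<Rightarrow> int poly) \<Rightarrow> bool" where
  "admissible Q \<longleftrightarrow> (\<forall>M. is_matroid M \<and> loopless M \<longrightarrow>
     (rk M = 0 \<longrightarrow> Q M = 1) \<and> (rk M > 0 \<longrightarrow> 2 * degree (Q M) < rk M))"

lemma admissible_degree:
  assumes "admissible Q" "is_matroid M" "loopless M"
  shows "degree (Q M) \<le> rk M"
proof (cases "rk M = 0")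
  case False
  then have "2 * degree (Q M) < rk M" using assms unfolding admissible_def by blast
  then show ?thesis by simp
qed (use assms in \<open>auto simp: admissible_def\<close>)

lemma admissible_coeff:
  assumes "admissible Q" "is_matroid M" "loopless M" "rk M \<le> 2 * i" "i > 0"
  shows "coeff (Q M) i = 0"
proof (rule coeff_eq_0)
  show "degree (Q M) < i"
  proof (cases "rk M = 0")
    case False
    then have "2 * degree (Q M) < rk M" using assms unfolding admissible_def by blast
    then show ?thesis using assms by simp
  qed (use assms in \<open>auto simp: admissible_def\<close>)
qed

lemma recip_sum: "recip d (\<Sum>x\<in>A. f x) = (\<Sum>x\<in>A. recip d (f x))"
  by (rule poly_eqI) (simp add: recip_coeff coeff_sum)

lemma recip_minus_one_power: "recip d ((-1) ^ e * p) = (-1) ^ e * recip d p"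
  by (rule poly_eqI) (cases "even e"; simp add: recip_coeff)

text \<open>The monomial uses up the additional e in the degree of reversal, so only its coefficient
  is left.\<close>

lemma recip_mult_monom:
  assumes "degree p \<le> d"
  shows "recip (d + e) (p * monom c e) = recip d p * [:c:]"
proof (rule poly_eqI)
  fix i
  show "coeff (recip (d + e) (p * monom c e)) i = coeff (recip d p * [:c:]) i"
    using assms by (auto simp: recip_coeff mult.commute[of _ "[:c:]"] mult.commute[of _ "monom c e"]
        coeff_monom_mult intro!: arg_cong[where f = "coeff p"])
qed

lemma yterm_eq:
  assumes "is_matroid M" "F \<in> flats M"
  shows "yterm Q M F = (-1) ^ rank_of M F * Q (restriction M F) *
     monom (moebius (flats M) F (ground M)) (rk M - rank_of M F)"
  using assms by (simp add: yterm_def mu_contraction rk_contraction flats_subset)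

lemma recip_yterm:
  assumes M: "is_matroid M" "loopless M" and Q: "admissible Q" and F: "F \<in> flats M"
  shows "recip (rk M) (yterm Q M F) = (-1) ^ rank_of M F *
     recip (rank_of M F) (Q (restriction M F)) * [:moebius (flats M) F (ground M):]"
proof -
  have "degree (Q (restriction M F)) \<le> rank_of M F"
    using admissible_degree[OF Q matroid_restriction[OF M(1)] loopless_restriction[OF M(2)]]
      flats_subset[OF F] by (simp add: rk_restriction)
  then show ?thesis
    using recip_mult_monom[of "Q (restriction M F)" "rank_of M F" "rk M - rank_of M F"]
      rank_le_rk[OF M(1) F]
    by (simp add: yterm_eq[OF M(1) F] mult.assoc recip_minus_one_power)
qed

lemma degree_yterm:
  assumes M: "is_matroid M" "loopless M" and Q: "admissible Q" and F: "F \<in> flats M"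
  shows "degree (yterm Q M F) \<le> rk M"
proof -
  have "degree (Q (restriction M F)) \<le> rank_of M F"
    using admissible_degree[OF Q matroid_restriction[OF M(1)] loopless_restriction[OF M(2)]]
      flats_subset[OF F] by (simp add: rk_restriction)
  moreover have "degree ((-1) ^ rank_of M F * Q (restriction M F)) = degree (Q (restriction M F))"
    by (cases "even (rank_of M F)") auto
  ultimately show ?thesis unfolding yterm_eq[OF M(1) F]
    using degree_mult_le[of "(-1) ^ rank_of M F * Q (restriction M F)"
        "monom (moebius (flats M) F (ground M)) (rk M - rank_of M F)"]
      degree_monom_le[of "moebius (flats M) F (ground M)" "rk M - rank_of M F"] rank_le_rk[OF M(1) F]
    by linarith
qed

section \<open>Equivalence of the recursion with palindromicity\<close>

definition kl_equation :: "('a matroid \<Rightarrow> int poly) \<Rightarrow> 'a matroid \<Rightarrow> bool" where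
  "kl_equation Q M \<longleftrightarrow> (-1) ^ rk M * recip (rk M) (Q M) =
     (\<Sum>F\<in>flats M. (-1) ^ rank_of M F * Q (restriction M F) *
        recip (rk (contraction M F)) (chi (contraction M F)))"

lemma ysum_restriction:
  assumes M: "is_matroid M" and G: "G \<in> flats M"
  shows "ysum Q (restriction M G) = (\<Sum>F | F \<in> flats M \<and> F \<subseteq> G. (-1) ^ rank_of M F *
    Q (restriction M F) * monom (moebius (flats M) F G) (rank_of M G - rank_of M F))"
proof -
  have sub: "G \<subseteq> ground M" by (rule flats_subset[OF G])
  have "moebius (flats (restriction M G)) F G = moebius (flats M) F G" for F
    by (rule moebius_cong[OF finite_subset[OF sub matroid_finite[OF M]]])
      (simp add: flats_restriction[OF M G])
  then show ?thesis
    unfolding ysum_def flats_restriction[OF M G]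
    by (intro sum.cong refl) (simp add: yterm_eq[OF matroid_restriction[OF M sub]]
        flats_restriction[OF M G] rank_restriction rk_restriction restriction_restriction)
qed

lemma sum_flats_swap:
  fixes g :: "'a set \<Rightarrow> 'a set \<Rightarrow> 'b::comm_monoid_add"
  assumes "is_matroid M"
  shows "(\<Sum>F\<in>flats M. \<Sum>G | G \<in> flats M \<and> F \<subseteq> G. g F G) =
    (\<Sum>G\<in>flats M. \<Sum>F | F \<in> flats M \<and> F \<subseteq> G. g F G)"
  using finite_flats[OF assms] by (rule sum.swap_restrict[OF _ finite_flats[OF assms]])

text \<open>Expand the reversed characteristic polynomials into a sum over pairs of flats F below G
  and swap the sums: for fixed G the inner sum is \<open>ysum\<close> of the restriction to
  G.\<close>

lemma kl_equation_iff_ysum: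
  assumes M: "is_matroid M"
  shows "kl_equation Q M \<longleftrightarrow>
    (-1) ^ rk M * recip (rk M) (Q M) = (\<Sum>G\<in>flats M. ysum Q (restriction M G))"
proof -
  have "(\<Sum>F\<in>flats M. (-1) ^ rank_of M F * Q (restriction M F) *
        recip (rk (contraction M F)) (chi (contraction M F))) =
    (\<Sum>F\<in>flats M. \<Sum>G | G \<in> flats M \<and> F \<subseteq> G. (-1) ^ rank_of M F * Q (restriction M F) *
        monom (moebius (flats M) F G) (rank_of M G - rank_of M F))"
    by (intro sum.cong refl) (simp add: recip_chi_contraction[OF M] sum_distrib_left)
  also have "\<dots> = (\<Sum>G\<in>flats M. ysum Q (restriction M G))"
    unfolding sum_flats_swap[OF M] by (intro sum.cong refl) (simp add: ysum_restriction[OF M])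
  finally show ?thesis unfolding kl_equation_def by simp
qed

text \<open>After reversal, only the constant \<open>moebius (flats M) F G\<close> in each term
  depends on G. Swapping the sums and summing it over all G above F leaves just F = E. The
  right-hand side is also one side of \<open>kl_equation_iff_ysum\<close>.\<close>

lemma sum_recip_ysum_restriction:
  assumes M: "is_matroid M" "loopless M" and Q: "admissible Q"
  shows "(\<Sum>G\<in>flats M. recip (rank_of M G) (ysum Q (restriction M G))) =
    (-1) ^ rk M * recip (rk M) (Q M)"
proof -
  define q where "q F = (-1) ^ rank_of M F * recip (rank_of M F) (Q (restriction M F))" for F
  have *: "recip (rank_of M G) (ysum Q (restriction M G)) =
      (\<Sum>F | F \<in> flats M \<and> F \<subseteq> G. q F * [:moebius (flats M) F G:])" if G: "G \<in> flats M" for G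
  proof -
    have sub: "G \<subseteq> ground M" by (rule flats_subset[OF G])
    have "moebius (flats (restriction M G)) F G = moebius (flats M) F G" for F
      by (rule moebius_cong[OF finite_subset[OF sub matroid_finite[OF M(1)]]])
        (simp add: flats_restriction[OF M(1) G])
    then show ?thesis
      unfolding ysum_def recip_sum flats_restriction[OF M(1) G] q_def
      by (intro sum.cong refl)
        (use recip_yterm[OF matroid_restriction[OF M(1) sub] loopless_restriction[OF M(2) sub] Q] in
          \<open>simp add: flats_restriction[OF M(1) G] rank_restriction rk_restriction
            restriction_restriction\<close>)
  qed
  have "(\<Sum>G\<in>flats M. recip (rank_of M G) (ysum Q (restriction M G))) =
      (\<Sum>F\<in>flats M. \<Sum>G | G \<in> flats M \<and> F \<subseteq> G. q F * [:moebius (flats M) F G:])"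
    unfolding sum_flats_swap[OF M(1)] by (intro sum.cong refl *)
  also have "\<dots> = (\<Sum>F\<in>flats M. if F = ground M then q F else 0)"
  proof (intro sum.cong refl)
    fix F assume F: "F \<in> flats M"
    have "{G \<in> flats M. F \<subseteq> G} = {G \<in> flats M. F \<subseteq> G \<and> G \<subseteq> ground M}"
      using flats_subset by blast
    moreover have "(\<Sum>G\<in>A. [:h G:]) = [:\<Sum>G\<in>A. h G:]" for A and h :: "'a set \<Rightarrow> int"
      by (induction A rule: infinite_finite_induct) auto
    ultimately have "(\<Sum>G | G \<in> flats M \<and> F \<subseteq> G. q F * [:moebius (flats M) F G:]) =
        q F * [:\<Sum>G | G \<in> flats M \<and> F \<subseteq> G \<and> G \<subseteq> ground M. moebius (flats M) F G:]"
      by (simp only: sum_distrib_left[symmetric])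
    also have "\<dots> = (if F = ground M then q F else 0)"
      using moebius_sum[OF matroid_finite[OF M(1)] flats_subset[OF F] ground_in_flats[of M]]
      by auto
    finally show "(\<Sum>G | G \<in> flats M \<and> F \<subseteq> G. q F * [:moebius (flats M) F G:]) = \<dots>" .
  qed
  also have "\<dots> = q (ground M)"
    using finite_flats[OF M(1)] ground_in_flats[of M] by (simp add: sum.delta)
  finally show ?thesis by (simp add: q_def restriction_ground[OF M(1)] rk_def)
qed

lemma kl_equation_if_palindromic:
  assumes M: "is_matroid M" "loopless M" and Q: "admissible Q"
    and pal: "\<And>G. G \<in> flats M \<Longrightarrow>
      recip (rank_of M G) (ysum Q (restriction M G)) = ysum Q (restriction M G)"
  shows "kl_equation Q M"
  using sum_recip_ysum_restriction[OF M Q] pal by (simp add: kl_equation_iff_ysum[OF M(1)])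

text \<open>Under the recursion, the reversed and the unreversed
  \<open>ysum Q (restriction M G)\<close> have the same sum over all flats G. By induction on the
  size of the ground set they agree for proper flats, hence also for G = E.\<close>

lemma palindromic_if_kl_equation:
  assumes Q: "admissible Q"
    and kl: "\<And>M. is_matroid M \<Longrightarrow> loopless M \<Longrightarrow> kl_equation Q M"
    and M: "is_matroid M" "loopless M"
  shows "recip (rk M) (ysum Q M) = ysum Q M"
  using M
proof (induction "card (ground M)" arbitrary: M rule: less_induct)
  case less
  let ?E = "ground M"
  have fin: "finite (flats M)" by (rule finite_flats[OF less.prems(1)])
  have IH: "recip (rank_of M G) (ysum Q (restriction M G)) = ysum Q (restriction M G)"
    if "G \<in> flats M - {?E}" for G
  proof -
    have "G \<subset> ?E" using that flats_subset by blast
    then show ?thesis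
      using less.hyps[of "restriction M G"] less.prems psubset_card_mono[of ?E G]
      by (simp add: matroid_finite matroid_restriction loopless_restriction rk_restriction psubset_eq)
  qed
  have "(\<Sum>G\<in>flats M. recip (rank_of M G) (ysum Q (restriction M G))) =
      (\<Sum>G\<in>flats M. ysum Q (restriction M G))"
    using sum_recip_ysum_restriction[OF less.prems Q] kl[OF less.prems]
    by (simp add: kl_equation_iff_ysum[OF less.prems(1)])
  then show ?case
    using IH by (simp add: sum.remove[OF fin ground_in_flats] restriction_ground less.prems rk_def)
qed

section \<open>Uniqueness and recursive construction\<close>

definition ytail :: "('a matroid \<Rightarrow> int poly) \<Rightarrow> 'a matroid \<Rightarrow> int poly" where
  "ytail Q M = (\<Sum>F\<in>flats M - {ground M}. yterm Q M F)"

lemma yterm_ground: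
  assumes "is_matroid M"
  shows "yterm Q M (ground M) = (-1) ^ rk M * Q M"
  by (simp add: yterm_eq[OF assms ground_in_flats] restriction_ground[OF assms] rk_def monom_0)

lemma ysum_eq_ytail:
  assumes "is_matroid M"
  shows "ysum Q M = (-1) ^ rk M * Q M + ytail Q M"
  by (simp add: ysum_def ytail_def sum.remove[OF finite_flats ground_in_flats] yterm_ground assms)

lemma degree_ytail:
  assumes "is_matroid M" "loopless M" "admissible Q"
  shows "degree (ytail Q M) \<le> rk M"
  unfolding ytail_def
  by (intro degree_sum_le) (auto simp: finite_flats degree_yterm assms)

text \<open>Proper flats give strictly smaller ground sets, so the tail is already determined when
  \<open>Q M\<close> is still to be chosen.\<close>

lemma ytail_cong:
  assumes M: "is_matroid M" "loopless M"
    and "\<And>N. is_matroid N \<Longrightarrow> loopless N \<Longrightarrow> card (ground N) < card (ground M) \<Longrightarrow> Q N = Q' N"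
  shows "ytail Q M = ytail Q' M"
proof -
  have "yterm Q M F = yterm Q' M F" if F: "F \<in> flats M - {ground M}" for F
  proof -
    have "F \<subset> ground M" using F flats_subset by auto
    then show ?thesis
      using assms(3)[of "restriction M F"] M
      by (simp add: yterm_def matroid_restriction loopless_restriction psubset_card_mono matroid_finite)
  qed
  then show ?thesis unfolding ytail_def by (intro sum.cong) auto
qed

lemma rank_zero_loopless:
  assumes "is_matroid M" "loopless M" "rk M = 0"
  shows "ground M = {}"
proof (rule ccontr)
  assume "ground M \<noteq> {}"
  then obtain x where x: "x \<in> ground M" by auto
  then have "{x} \<in> indep M" using assms(2) by (auto simp: loopless_def loops_def)
  then have "card {x} \<le> rk M"
    unfolding rk_def using x by (intro indep_card_le_rank[OF assms(1)]) auto
  then show False using assms(3) by simp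
qed

text \<open>The two conditions are compared over all loopless matroids at once: each direction
  applies its premise to restrictions to flats as well.\<close>

lemma is_inverse_KL_iff:
  "is_inverse_KL Q \<longleftrightarrow> admissible Q \<and>
    (\<forall>M. is_matroid M \<and> loopless M \<longrightarrow> recip (rk M) (ysum Q M) = ysum Q M) \<and>
    (\<forall>M. \<not> (is_matroid M \<and> loopless M) \<longrightarrow> Q M = 0)"
proof -
  have "is_inverse_KL Q \<longleftrightarrow> admissible Q \<and>
    (\<forall>M. is_matroid M \<and> loopless M \<longrightarrow> kl_equation Q M) \<and>
    (\<forall>M. \<not> (is_matroid M \<and> loopless M) \<longrightarrow> Q M = 0)"
    unfolding is_inverse_KL_def admissible_def kl_equation_def by blast
  moreover have "(\<forall>M. is_matroid M \<and> loopless M \<longrightarrow> kl_equation Q M) \<longleftrightarrow>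
    (\<forall>M. is_matroid M \<and> loopless M \<longrightarrow> recip (rk M) (ysum Q M) = ysum Q M)" if "admissible Q"
    using palindromic_if_kl_equation[OF that] kl_equation_if_palindromic[OF _ _ that]
      matroid_restriction loopless_restriction rk_restriction flats_subset by metis
  ultimately show ?thesis by blast
qed

lemma coeff_minus_one_power: "coeff ((-1) ^ e * p) i = (-1) ^ e * coeff p i"
  for p :: "'a::comm_ring_1 poly"
  by (cases "even e") auto

text \<open>By induction the tails agree, so the difference of the two palindromic sums is
  \<open>?D\<close> up to sign. It is palindromic in degree \<open>rk M\<close> and zero from degree
  \<open>rk M / 2\<close> on, hence zero.\<close>

lemma is_inverse_KL_unique:
  assumes "is_inverse_KL Q" "is_inverse_KL Q'"
  shows "Q = Q'"
proof
  fix M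
  have ad: "admissible Q" "admissible Q'"
    using assms by (auto simp: is_inverse_KL_iff)
  show "Q M = Q' M"
  proof (cases "is_matroid M \<and> loopless M")
    case True
    then have M: "is_matroid M" "loopless M" by auto
    from M show ?thesis
    proof (induction "card (ground M)" arbitrary: M rule: less_induct)
      case less
      let ?D = "Q M - Q' M"
      have "ytail Q M = ytail Q' M"
        using less.prems less.hyps by (intro ytail_cong) auto
      then have eq: "ysum Q M - ysum Q' M = (-1) ^ rk M * ?D"
        by (simp add: ysum_eq_ytail[OF less.prems(1)] algebra_simps)
      have pal: "recip (rk M) (ysum Q M) = ysum Q M" "recip (rk M) (ysum Q' M) = ysum Q' M"
        using assms less.prems by (auto simp: is_inverse_KL_iff)
      have sym: "coeff ?D i = coeff ?D (rk M - i)" if "i \<le> rk M" for i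
      proof -
        have "coeff (ysum Q M - ysum Q' M) i = coeff (ysum Q M - ysum Q' M) (rk M - i)"
          using arg_cong[OF pal(1), of "\<lambda>p. coeff p i"] arg_cong[OF pal(2), of "\<lambda>p. coeff p i"] that
          by (simp add: recip_coeff)
        then show ?thesis unfolding eq coeff_minus_one_power by simp
      qed
      show ?case
      proof (cases "rk M = 0")
        case True
        then show ?thesis using ad less.prems by (simp add: admissible_def)
      next
        case False
        have z: "coeff ?D i = 0" if "rk M \<le> 2 * i" for i
          using admissible_coeff[OF ad(1) less.prems that] admissible_coeff[OF ad(2) less.prems that]
            that False by simp
        have "coeff ?D i = 0" for i
          using z[of i] z[of "rk M - i"] sym[of i] by (cases "rk M \<le> 2 * i") auto
        then show ?thesis by (intro poly_eqI) simp
      qed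
    qed
  next
    case False
    then show ?thesis using assms by (auto simp: is_inverse_KL_iff)
  qed
qed

text \<open>The part of degree below \<open>r / 2\<close> that makes \<open>p\<close>, of degree at most \<open>r\<close>,
  palindromic when it is added to it.\<close>
definition symmetrizer :: "nat \<Rightarrow> int poly \<Rightarrow> int poly" where
  "symmetrizer r p = (\<Sum>i | 2 * i < r. monom (coeff p (r - i) - coeff p i) i)"

lemma coeff_symmetrizer:
  "coeff (symmetrizer r p) i = (if 2 * i < r then coeff p (r - i) - coeff p i else 0)"
proof -
  have "finite {i. 2 * i < r}" by (rule finite_subset[of _ "{..r}"]) auto
  then show ?thesis unfolding symmetrizer_def coeff_sum coeff_monom by (simp add: sum.delta)
qed

text \<open>Existence. The sign in front cancels the sign that the term at E carries in
  \<open>ysum\<close>, and the value 0 outside loopless matroids meets the last clause of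
  \<open>is_inverse_KL\<close>.\<close>

function kl_rec :: "'a matroid \<Rightarrow> int poly" where
  "kl_rec M = (if is_matroid M \<and> loopless M then
     if rk M = 0 then 1
     else (-1) ^ rk M * symmetrizer (rk M)
       (\<Sum>F\<in>flats M - {ground M}. (-1) ^ rank_of M F * kl_rec (restriction M F) *
         monom (mu (contraction M F)) (rk (contraction M F)))
     else 0)"
  by pat_completeness auto
termination
proof (relation "measure (\<lambda>M. card (ground M))")
  fix M :: "'a matroid" and F
  assume "is_matroid M \<and> loopless M" "F \<in> flats M - {ground M}"
  then show "(restriction M F, M) \<in> measure (\<lambda>M. card (ground M))"
    using flats_subset[of F M] by (auto intro!: psubset_card_mono simp: matroid_finite)
qed simp

declare kl_rec.simps [simp del]

lemma kl_rec_eq: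
  assumes "is_matroid M" "loopless M" "rk M > 0"
  shows "kl_rec M = (-1) ^ rk M * symmetrizer (rk M) (ytail kl_rec M)"
  using assms by (subst kl_rec.simps) (simp add: ytail_def yterm_def)

lemma admissible_kl_rec: "admissible kl_rec"
  unfolding admissible_def
proof (intro allI impI conjI)
  fix M :: "'a matroid" assume M: "is_matroid M \<and> loopless M"
  show "kl_rec M = 1" if "rk M = 0" using M that by (simp add: kl_rec.simps)
  show "2 * degree (kl_rec M) < rk M" if "0 < rk M"
  proof -
    have "degree (kl_rec M) \<le> (rk M - 1) div 2"
      by (intro degree_le) (use M that in
        \<open>auto simp: kl_rec_eq coeff_minus_one_power coeff_symmetrizer\<close>)
    then show ?thesis using that by linarith
  qed
qed

lemma is_inverse_KL_kl_rec: "is_inverse_KL kl_rec"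
  unfolding is_inverse_KL_iff
proof (intro conjI allI impI admissible_kl_rec)
  fix M :: "'a matroid" assume M: "is_matroid M \<and> loopless M"
  show "recip (rk M) (ysum kl_rec M) = ysum kl_rec M"
  proof (cases "rk M = 0")
    case True
    then have "flats M - {ground M} = {}"
      using rank_zero_loopless[of M] M flats_subset[of _ M] by auto
    then have "ytail kl_rec M = 0" by (simp only: ytail_def sum.empty)
    then have "ysum kl_rec M = 1"
      using M True by (simp add: ysum_eq_ytail kl_rec.simps)
    then show ?thesis using True by (simp add: recip_def monom_0)
  next
    case False
    then have "ysum kl_rec M = symmetrizer (rk M) (ytail kl_rec M) + ytail kl_rec M"
      using M by (simp add: ysum_eq_ytail kl_rec_eq mult.assoc[symmetric] power_add[symmetric])
    \<comment> \<open>If neither i nor its mirror image lies below half the rank, then i is the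
      middle degree, which reversal fixes.\<close>
    moreover have "coeff (ytail kl_rec M) (rk M - i) = coeff (ytail kl_rec M) i"
      if "\<not> 2 * i < rk M" "\<not> 2 * (rk M - i) < rk M" "i \<le> rk M" for i
      using that by (intro arg_cong[where f = "coeff _"]) linarith
    ultimately show ?thesis
      using degree_ytail[OF _ _ admissible_kl_rec, of M] M
      by (intro poly_eqI) (auto simp: recip_coeff coeff_symmetrizer coeff_eq_0)
  qed
qed (subst kl_rec.simps, auto)

lemma is_inverse_KL_inverse_KL: "is_inverse_KL inverse_KL"
  unfolding inverse_KL_def
  by (rule theI[of is_inverse_KL, OF is_inverse_KL_kl_rec])
    (rule is_inverse_KL_unique[OF _ is_inverse_KL_kl_rec])

lemma admissible_inverse_KL: "admissible inverse_KL"
  by (rule is_inverse_KL_inverse_KL[unfolded is_inverse_KL_iff, THEN conjunct1])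

lemma inverse_Z_loopless_eq: "inverse_Z_loopless M = (-1) ^ rk M * ysum inverse_KL M"
  by (simp add: inverse_Z_loopless_def ysum_def yterm_def)

lemma inverse_Z_loopless_eq_ytail:
  assumes "is_matroid M"
  shows "inverse_Z_loopless M = inverse_KL M + (-1) ^ rk M * ytail inverse_KL M"
  by (simp add: inverse_Z_loopless_eq ysum_eq_ytail assms ring_distribs mult.assoc[symmetric]
      power_add[symmetric])

lemma inverse_Z_loopless_palindromic:
  assumes "is_matroid M" "loopless M" "i \<le> rk M"
  shows "coeff (inverse_Z_loopless M) (rk M - i) = coeff (inverse_Z_loopless M) i"
proof -
  have "recip (rk M) (ysum inverse_KL M) = ysum inverse_KL M"
    using is_inverse_KL_inverse_KL[unfolded is_inverse_KL_iff, THEN conjunct2, THEN conjunct1] assms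
    by blast
  from arg_cong[OF this, of "\<lambda>p. coeff p i"] show ?thesis
    using assms(3) by (simp add: inverse_Z_loopless_eq coeff_minus_one_power recip_coeff)
qed

section \<open>Flats and Moebius function of a sparse paving matroid\<close>

lemma sum_subsets_card:
  fixes g :: "nat \<Rightarrow> int"
  assumes A: "finite A"
  shows "(\<Sum>V | V \<subseteq> A \<and> card V \<le> p. g (card V)) = (\<Sum>i\<le>p. of_nat (card A choose i) * g i)"
proof -
  have fin: "finite {V. V \<subseteq> A \<and> card V \<le> p}"
    using A by (auto intro: finite_subset[of _ "Pow A"])
  have "(\<Sum>V | V \<subseteq> A \<and> card V \<le> p. g (card V)) =
      (\<Sum>i\<le>p. \<Sum>V | V \<in> {V. V \<subseteq> A \<and> card V \<le> p} \<and> card V = i. g (card V))"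
    by (rule sum.group[symmetric, OF fin]) auto
  also have "\<dots> = (\<Sum>i\<le>p. of_nat (card A choose i) * g i)"
  proof (intro sum.cong refl)
    fix i assume "i \<in> {..p}"
    then have "{V \<in> {V. V \<subseteq> A \<and> card V \<le> p}. card V = i} = {V. V \<subseteq> A \<and> card V = i}" by auto
    then show "(\<Sum>V | V \<in> {V. V \<subseteq> A \<and> card V \<le> p} \<and> card V = i. g (card V)) =
        of_nat (card A choose i) * g i"
      by (simp add: n_subsets[OF A])
  qed
  finally show ?thesis .
qed

text \<open>Pascal's rule for \<open>m choose Suc p\<close> makes the sum telescope.\<close>

lemma alternating_choose_partial_sum:
  assumes "m > 0"
  shows "(\<Sum>i\<le>p. of_nat (m choose i) * (-1) ^ i) = ((-1) ^ p * of_nat (m - 1 choose p) :: int)"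
proof (induction p)
  case (Suc p)
  have "m choose Suc p = (m - 1 choose p) + (m - 1 choose Suc p)"
    using assms by (cases m) auto
  then show ?case using Suc by (simp add: algebra_simps)
qed simp

lemma interval_bij:
  assumes "finite E" "F \<subseteq> E"
  shows "bij_betw (\<lambda>V. V \<union> F) {V. V \<subseteq> E - F \<and> P (card V)}
    {Z. F \<subseteq> Z \<and> Z \<subseteq> E \<and> P (card Z - card F)}"
proof (rule bij_betw_byWitness[where f' = "\<lambda>Z. Z - F"])
  have c: "card (V \<union> F) = card V + card F" if "V \<subseteq> E - F" for V
    using that assms by (intro card_Un_disjoint) (auto intro: finite_subset)
  then show "(\<lambda>V. V \<union> F) ` {V. V \<subseteq> E - F \<and> P (card V)} \<subseteq>
      {Z. F \<subseteq> Z \<and> Z \<subseteq> E \<and> P (card Z - card F)}"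
    using assms by (auto simp: c)
  show "(\<lambda>Z. Z - F) ` {Z. F \<subseteq> Z \<and> Z \<subseteq> E \<and> P (card Z - card F)} \<subseteq>
      {V. V \<subseteq> E - F \<and> P (card V)}"
    using assms by (auto simp: card_Diff_subset finite_subset)
qed auto

text \<open>This is the sum in the Moebius recursion over a Boolean interval truncated above
  relative rank p. Intervals of flats below a circuit-hyperplane have this shape, and those below E
  have it up to corrections.\<close>

lemma alternating_interval_sum:
  assumes "finite E" "F \<subset> E"
  shows "(\<Sum>Z | F \<subseteq> Z \<and> Z \<subseteq> E \<and> card Z - card F \<le> p. (-1) ^ (card Z - card F)) =
    ((-1) ^ p * of_nat (card E - card F - 1 choose p) :: int)"
proof -
  have E: "finite E" "F \<subseteq> E" "finite F" using assms finite_subset by auto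
  have "card F < card E" using assms by (intro psubset_card_mono)
  then have pos: "card (E - F) > 0" using E by (simp add: card_Diff_subset)
  have c: "card (V \<union> F) - card F = card V" if "V \<subseteq> E - F" for V
  proof -
    have "card (V \<union> F) = card V + card F"
      using that E by (intro card_Un_disjoint) (auto intro: finite_subset)
    then show ?thesis by simp
  qed
  have "(\<Sum>Z | F \<subseteq> Z \<and> Z \<subseteq> E \<and> card Z - card F \<le> p. (-1) ^ (card Z - card F) :: int) =
      (\<Sum>V | V \<subseteq> E - F \<and> card V \<le> p. (-1) ^ (card (V \<union> F) - card F))"
    by (rule sum.reindex_bij_betw[OF interval_bij[OF E(1,2), where P = "\<lambda>c. c \<le> p"], symmetric])
  also have "\<dots> = (\<Sum>V | V \<subseteq> E - F \<and> card V \<le> p. (-1) ^ card V)"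
    by (intro sum.cong refl) (simp add: c)
  also have "\<dots> = (-1) ^ p * of_nat (card (E - F) - 1 choose p)"
    using sum_subsets_card[of "E - F" "\<lambda>i. (-1) ^ i" p] E(1)
      alternating_choose_partial_sum[OF pos, of p] by simp
  finally show ?thesis using E by (simp add: card_Diff_subset)
qed

lemma card_interval:
  assumes "finite E" "F \<subseteq> E"
  shows "card {Z. F \<subseteq> Z \<and> Z \<subseteq> E \<and> card Z - card F = p} = (card E - card F choose p)"
  using bij_betw_same_card[OF interval_bij[OF assms, where P = "\<lambda>c. c = p"]] assms
    n_subsets[of "E - F" p] finite_subset[OF assms(2,1)]
  by (simp add: card_Diff_subset)

text \<open>The recursion runs over all relative ranks up to p = |Y| - |X| - 1, so its alternating
  sum is \<open>(-1) ^ p\<close> times \<open>p choose p\<close>.\<close>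

lemma moebius_boolean:
  assumes "finite Y" "X \<subseteq> Y" "\<And>Z. X \<subseteq> Z \<Longrightarrow> Z \<subset> Y \<Longrightarrow> Z \<in> L"
  shows "moebius L X Y = (-1) ^ (card Y - card X)"
  using assms
proof (induction "card Y" arbitrary: Y rule: less_induct)
  case less
  show ?case
  proof (cases "X = Y")
    case False
    then have X: "X \<subset> Y" using less.prems by auto
    have lt: "card X < card Y" by (rule psubset_card_mono[OF less.prems(1) X])
    define p where "p = card Y - card X - 1"
    have p: "card Y - card X = Suc p" using lt by (simp add: p_def)
    have set_eq: "{Z \<in> L. X \<subseteq> Z \<and> Z \<subset> Y} = {Z. X \<subseteq> Z \<and> Z \<subseteq> Y \<and> card Z - card X \<le> p}"
    proof (intro equalityI subsetI)
      fix Z assume "Z \<in> {Z \<in> L. X \<subseteq> Z \<and> Z \<subset> Y}"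
      then show "Z \<in> {Z. X \<subseteq> Z \<and> Z \<subseteq> Y \<and> card Z - card X \<le> p}"
        using psubset_card_mono[OF less.prems(1), of Z] p by auto
    next
      fix Z assume "Z \<in> {Z. X \<subseteq> Z \<and> Z \<subseteq> Y \<and> card Z - card X \<le> p}"
      then show "Z \<in> {Z \<in> L. X \<subseteq> Z \<and> Z \<subset> Y}"
        using p less.prems(3)[of Z] by (cases "Z = Y") auto
    qed
    have "moebius L X Y = - (\<Sum>Z | Z \<in> L \<and> X \<subseteq> Z \<and> Z \<subset> Y. (-1) ^ (card Z - card X))"
    proof (subst moebius_rec[OF X less.prems(1)], intro arg_cong[where f = uminus] sum.cong refl)
      fix Z assume Z: "Z \<in> {Z \<in> L. X \<subseteq> Z \<and> Z \<subset> Y}"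
      then show "moebius L X Z = (-1) ^ (card Z - card X)"
        using less.prems by (intro less.hyps psubset_card_mono) (blast intro: finite_subset)+
    qed
    also have "\<dots> = - ((-1) ^ p * of_nat (card Y - card X - 1 choose p))"
      unfolding set_eq by (simp add: alternating_interval_sum[OF less.prems(1) X])
    finally show ?thesis using p by simp
  qed simp
qed

text \<open>\<open>CC\<close> is the set of circuit-hyperplanes.\<close>
locale sparse_matroid =
  fixes M :: "'a matroid" and k :: nat and CC :: "'a set set"
  assumes matroid: "is_matroid M"
    and indep_iff: "I \<in> indep M \<longleftrightarrow> I \<subseteq> ground M \<and> card I \<le> k \<and> I \<notin> CC"
    and CC_subset: "C \<in> CC \<Longrightarrow> C \<subseteq> ground M"
    and CC_card: "C \<in> CC \<Longrightarrow> card C = k"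
    and CC_inter: "C \<in> CC \<Longrightarrow> C' \<in> CC \<Longrightarrow> C \<noteq> C' \<Longrightarrow> card (C \<inter> C') + 2 \<le> k"
    and k_pos: "1 \<le> k"
    and CC_k: "CC \<noteq> {} \<Longrightarrow> 2 \<le> k"
    and rk_eq: "rk M = k"
begin

abbreviation "E \<equiv> ground M"
abbreviation "n \<equiv> card (ground M)"

text \<open>For F in \<open>sflats\<close> this is, up to sign, the difference between the Moebius
  value from F to E and its value in the uniform matroid; see \<open>moebius_top\<close>.\<close>

definition cdeg :: "'a set \<Rightarrow> nat" where
  "cdeg F = card {C \<in> CC. F \<subseteq> C}"

lemma finE: "finite E"
  by (rule matroid_finite[OF matroid])

lemma finCC: "finite CC"
  using CC_subset finE by (auto intro: finite_subset[of _ "Pow E"])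

lemma finite_sub: "X \<subseteq> E \<Longrightarrow> finite X"
  using finE finite_subset by auto

lemma k_le_n: "k \<le> n"
  using rank_le_card[OF matroid finE] by (simp add: rk_eq[symmetric] rk_def)

lemma rank_le_k: "rank_of M X \<le> k"
  by (rule rank_le[OF matroid]) (simp add: indep_iff)

lemma rank_small: "X \<subseteq> E \<Longrightarrow> card X < k \<Longrightarrow> rank_of M X = card X"
  using CC_card by (intro rank_indep[OF matroid]) (auto simp: indep_iff)

lemma rank_basis: "X \<subseteq> E \<Longrightarrow> card X = k \<Longrightarrow> X \<notin> CC \<Longrightarrow> rank_of M X = k"
  using rank_indep[OF matroid, of X] by (simp add: indep_iff)

lemma rank_CC:
  assumes C: "C \<in> CC"
  shows "rank_of M C = k - 1"
proof (rule antisym)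
  have fC: "finite C" "card C = k" using C CC_subset CC_card finite_sub by auto
  show "rank_of M C \<le> k - 1"
  proof (rule rank_le[OF matroid])
    fix I assume I: "I \<in> indep M" "I \<subseteq> C"
    then have "I \<subset> C" using C by (auto simp: indep_iff)
    then show "card I \<le> k - 1" using psubset_card_mono[OF fC(1), of I] fC by linarith
  qed
  obtain x where x: "x \<in> C" using fC k_pos by fastforce
  have "rank_of M (C - {x}) = k - 1"
    using rank_small[of "C - {x}"] x fC CC_subset[OF C] k_pos by (auto simp: card_Diff_singleton)
  then show "k - 1 \<le> rank_of M C" using rank_mono[OF matroid, of "C - {x}" C] by auto
qed

text \<open>A (k+1)-subset A of X contains a basis: two distinct k-subsets of A meet in k - 1
  elements, so \<open>CC_inter\<close> forbids that both are in \<open>CC\<close>.\<close>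

lemma rank_big:
  assumes X: "X \<subseteq> E" "k < card X"
  shows "rank_of M X = k"
proof -
  obtain A where A: "A \<subseteq> X" "card A = Suc k"
    using obtain_subset_with_card_n[of "Suc k" X] X(2) by (metis Suc_leI)
  have fA: "finite A" using A by (intro card_ge_0_finite) simp
  have "\<not> is_singleton A" using A k_pos by (auto simp: is_singleton_altdef)
  moreover have "A \<noteq> {}" using A by auto
  ultimately obtain x y where xy: "x \<in> A" "y \<in> A" "x \<noteq> y"
    by (metis is_singletonI')
  have "\<exists>z\<in>A. A - {z} \<notin> CC"
  proof (rule ccontr)
    assume "\<not> ?thesis"
    then have CC: "A - {x} \<in> CC" "A - {y} \<in> CC" using xy by auto
    have "A - {x} \<noteq> A - {y}" using xy by auto
    from CC_inter[OF CC this] have "card ((A - {x}) \<inter> (A - {y})) + 2 \<le> k" .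
    moreover have "(A - {x}) \<inter> (A - {y}) = A - {x} - {y}" by auto
    moreover have "card (A - {x} - {y}) = k - 1" using xy A fA by simp
    ultimately show False by simp
  qed
  then obtain z where z: "z \<in> A" "A - {z} \<notin> CC" by auto
  have "rank_of M (A - {z}) = k"
    using z A X fA by (intro rank_basis) auto
  moreover have "rank_of M (A - {z}) \<le> rank_of M X"
    using A by (intro rank_mono[OF matroid]) auto
  ultimately show ?thesis using rank_le_k[of X] by simp
qed

text \<open>A loop would be a singleton member of \<open>CC\<close>, which \<open>CC_k\<close> rules
  out.\<close>

lemma loopless: "loopless M"
proof -
  have "{x} \<in> indep M" if "x \<in> E" for x
  proof -
    have "{x} \<notin> CC"
    proof
      assume "{x} \<in> CC"
      then have "2 \<le> k" "card {x} = k" using CC_k CC_card by blast+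
      then show False by simp
    qed
    then show ?thesis using that k_pos by (simp add: indep_iff)
  qed
  then show ?thesis by (auto simp: loopless_def loops_def)
qed

lemma ground_notin_CC: "E \<notin> CC"
proof
  assume "E \<in> CC"
  from rank_CC[OF this] show False using rk_eq k_pos by (simp add: rk_def)
qed

text \<open>These are the independent proper flats. A (k-1)-set inside a circuit-hyperplane is left
  out because it is not closed.\<close>

definition sflats :: "'a set set" where
  "sflats = {F. F \<subseteq> E \<and> card F < k \<and> (Suc (card F) = k \<longrightarrow> cdeg F = 0)}"

lemma cdeg_eq_0: "cdeg F = 0 \<longleftrightarrow> (\<forall>C\<in>CC. \<not> F \<subseteq> C)"
  unfolding cdeg_def by (subst card_0_eq) (use finCC in auto)

text \<open>A proper flat has rank below k, which leaves sets of size below k and members of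
  \<open>CC\<close>. If a (k-1)-set lies in some C of \<open>CC\<close>, adding the missing element
  of C gives C, still of rank k - 1, so the set is not a flat.\<close>

lemma proper_flats: "flats M - {E} = sflats \<union> CC"
proof (intro equalityI subsetI)
  fix F assume "F \<in> flats M - {E}"
  then have F: "F \<in> flats M" "F \<subseteq> E" "F \<noteq> E" using flats_subset by auto
  then obtain x where x: "x \<in> E - F" by auto
  have lt: "rank_of M F < rank_of M (insert y F)" if "y \<in> E - F" for y
    using F that by (simp add: flats_def)
  have "rank_of M F < k" using lt[OF x] rank_le_k[of "insert x F"] by simp
  then have "card F < k \<or> F \<in> CC"
    using rank_big[OF F(2)] rank_basis[OF F(2)] by (cases "card F" k rule: linorder_cases) auto
  moreover have "cdeg F = 0" if "Suc (card F) = k"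
    unfolding cdeg_eq_0
  proof (intro ballI notI)
    fix C assume C: "C \<in> CC" "F \<subseteq> C"
    have fC: "finite C" using C CC_subset finite_sub by auto
    have "F \<noteq> C" using that CC_card[OF C(1)] by auto
    then obtain y where y: "y \<in> C - F" using C by auto
    have "insert y F \<subseteq> C" "card (insert y F) = card C"
      using y C that CC_card[OF C(1)] finite_sub[OF F(2)] by auto
    then have "insert y F = C" using fC by (intro card_subset_eq)
    then have "rank_of M F < k - 1" using lt[of y] y rank_CC[OF C(1)] CC_subset[OF C(1)] by auto
    then show False using rank_small[OF F(2)] that by simp
  qed
  ultimately show "F \<in> sflats \<union> CC" using F by (auto simp: sflats_def)
next
  fix F assume "F \<in> sflats \<union> CC"
  then show "F \<in> flats M - {E}"
  proof
    assume F: "F \<in> sflats"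
    have "rank_of M F < rank_of M (insert x F)" if x: "x \<in> E - F" for x
    proof -
      have c: "card (insert x F) = Suc (card F)" "insert x F \<subseteq> E"
        using F x finite_sub[of F] by (auto simp: sflats_def)
      have "insert x F \<notin> CC" if "Suc (card F) = k"
        using F that unfolding sflats_def cdeg_eq_0 by auto
      then have "rank_of M (insert x F) = Suc (card F)"
        using rank_small[of "insert x F"] rank_basis[of "insert x F"] c F
        by (cases "Suc (card F) = k") (auto simp: sflats_def)
      then show ?thesis using rank_small[of F] F by (simp add: sflats_def)
    qed
    then show ?thesis using F k_le_n by (auto simp: sflats_def flats_def)
  next
    assume F: "F \<in> CC"
    have "rank_of M F < rank_of M (insert x F)" if x: "x \<in> E - F" for x
    proof -
      have "card (insert x F) = Suc k" "insert x F \<subseteq> E"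
        using x CC_card[OF F] CC_subset[OF F] finite_sub[of F] by auto
      then show ?thesis using rank_big[of "insert x F"] rank_CC[OF F] k_pos by simp
    qed
    then show ?thesis using F CC_subset ground_notin_CC by (auto simp: flats_def)
  qed
qed

lemma flats_iff: "F \<in> flats M \<longleftrightarrow> F = E \<or> F \<in> sflats \<or> F \<in> CC"
proof -
  have "F \<in> flats M - {E} \<longleftrightarrow> F \<in> sflats \<union> CC" by (simp only: proper_flats)
  then show ?thesis using ground_in_flats[of M] by auto
qed

lemma sflats_CC_disjoint: "sflats \<inter> CC = {}"
  using CC_card by (auto simp: sflats_def)

lemma finite_sflats: "finite sflats"
  using finE by (auto simp: sflats_def intro: finite_subset[of _ "Pow E"])

lemma moebius_sflats:
  assumes Z: "Z \<in> sflats" and "F \<subseteq> Z"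
  shows "moebius (flats M) F Z = (-1) ^ (card Z - card F)"
proof (rule moebius_boolean)
  show "finite Z" using Z finite_sub by (auto simp: sflats_def)
  fix W assume "F \<subseteq> W" and W: "W \<subset> Z"
  have "card W < card Z" using Z W finite_sub by (intro psubset_card_mono) (auto simp: sflats_def)
  then have "W \<in> sflats" using W Z by (auto simp: sflats_def)
  then show "W \<in> flats M" using proper_flats by auto
qed fact

lemma cdeg_le_1:
  assumes Z: "Z \<subseteq> E" "Suc (card Z) = k"
  shows "cdeg Z \<le> 1"
proof -
  have "C = C'" if C: "C \<in> CC" "Z \<subseteq> C" "C' \<in> CC" "Z \<subseteq> C'" for C C'
  proof (rule ccontr)
    assume "C \<noteq> C'"
    with C have "card (C \<inter> C') + 2 \<le> k" by (intro CC_inter)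
    moreover have "card Z \<le> card (C \<inter> C')"
      using C finite_sub[of C] CC_subset by (intro card_mono) auto
    ultimately show False using Z by simp
  qed
  then show ?thesis
    unfolding cdeg_def by (auto simp: card_le_Suc0_iff_eq finCC)
qed

text \<open>No (k-1)-subset of C is a flat, so the part of the interval strictly below C is Boolean,
  cut off at size k - 2. The truncated alternating sum yields \<open>Suc p choose p\<close>.\<close>

lemma moebius_CC:
  assumes C: "C \<in> CC" and F: "F \<subseteq> C" "card F + 2 \<le> k"
  shows "moebius (flats M) F C = (-1) ^ (k - 1 - card F) * of_nat (k - 1 - card F)"
proof -
  have fC: "finite C" "card C = k" using C CC_subset CC_card finite_sub by auto
  have ps: "F \<subset> C" using F fC by auto
  define p where "p = k - 2 - card F"
  have p: "k - 1 - card F = Suc p" using F by (simp add: p_def)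
  have set_eq: "{Z \<in> flats M. F \<subseteq> Z \<and> Z \<subset> C} = {Z. F \<subseteq> Z \<and> Z \<subseteq> C \<and> card Z - card F \<le> p}"
  proof (intro equalityI subsetI)
    fix Z assume Z: "Z \<in> {Z \<in> flats M. F \<subseteq> Z \<and> Z \<subset> C}"
    then have lt: "card Z < k" using psubset_card_mono[OF fC(1), of Z] fC by auto
    have "Z \<noteq> E" using Z CC_subset[OF C] by auto
    moreover have "Z \<notin> CC" using lt CC_card[of Z] by auto
    ultimately have "Z \<in> sflats" using Z flats_iff by simp
    then have "Suc (card Z) \<noteq> k" using Z C by (auto simp: sflats_def cdeg_eq_0)
    then show "Z \<in> {Z. F \<subseteq> Z \<and> Z \<subseteq> C \<and> card Z - card F \<le> p}" using Z lt by (auto simp: p_def)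
  next
    fix Z assume Z: "Z \<in> {Z. F \<subseteq> Z \<and> Z \<subseteq> C \<and> card Z - card F \<le> p}"
    then have "card Z + 2 \<le> k" using F by (auto simp: p_def)
    moreover from this have "Z \<noteq> C" using fC by auto
    ultimately show "Z \<in> {Z \<in> flats M. F \<subseteq> Z \<and> Z \<subset> C}"
      using Z CC_subset[OF C] by (auto simp: flats_iff sflats_def)
  qed
  have "Z \<in> sflats" if Z: "Z \<in> flats M" "Z \<subset> C" for Z
  proof -
    have "Z \<noteq> E" using Z CC_subset[OF C] by auto
    moreover have "Z \<notin> CC" using psubset_card_mono[OF fC(1) Z(2)] CC_card[of Z] fC by auto
    ultimately show ?thesis using Z flats_iff by simp
  qed
  then have "moebius (flats M) F C =
      - (\<Sum>Z | Z \<in> flats M \<and> F \<subseteq> Z \<and> Z \<subset> C. (-1) ^ (card Z - card F))"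
    by (subst moebius_rec[OF ps fC(1)], intro arg_cong[where f = uminus] sum.cong refl)
      (simp add: moebius_sflats)
  also have "\<dots> = - ((-1) ^ p * of_nat (card C - card F - 1 choose p))"
    unfolding set_eq by (simp add: alternating_interval_sum[OF fC(1) ps])
  also have "card C - card F - 1 = Suc p" using fC p by simp
  finally show ?thesis using p by simp
qed

text \<open>Double counting of the pairs of a set Z and a circuit-hyperplane containing it.\<close>

lemma sum_cdeg:
  assumes "F \<subseteq> E"
  shows "(\<Sum>Z | F \<subseteq> Z \<and> Z \<subseteq> E \<and> card Z - card F = p. cdeg Z) = cdeg F * (k - card F choose p)"
proof -
  let ?S = "{Z. F \<subseteq> Z \<and> Z \<subseteq> E \<and> card Z - card F = p}"
  have fS: "finite ?S" using finE by (auto intro: finite_subset[of _ "Pow E"])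
  have "(\<Sum>Z\<in>?S. cdeg Z) = (\<Sum>Z\<in>?S. \<Sum>C | C \<in> CC \<and> Z \<subseteq> C. 1)" by (simp add: cdeg_def)
  also have "\<dots> = (\<Sum>C\<in>CC. \<Sum>Z | Z \<in> ?S \<and> Z \<subseteq> C. 1)" by (rule sum.swap_restrict[OF fS finCC])
  also have "\<dots> = (\<Sum>C\<in>CC. if F \<subseteq> C then (k - card F choose p) else 0)"
  proof (intro sum.cong refl)
    fix C assume C: "C \<in> CC"
    have "{Z \<in> ?S. Z \<subseteq> C} = (if F \<subseteq> C then {Z. F \<subseteq> Z \<and> Z \<subseteq> C \<and> card Z - card F = p} else {})"
      using CC_subset[OF C] by auto
    then show "(\<Sum>Z | Z \<in> ?S \<and> Z \<subseteq> C. 1) = (if F \<subseteq> C then (k - card F choose p) else 0)"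
      using card_interval[of C F p] CC_card[OF C] finite_sub[OF CC_subset[OF C]] by simp
  qed
  also have "\<dots> = cdeg F * (k - card F choose p)"
    using finCC by (simp add: sum.If_cases cdeg_def Int_def)
  finally show ?thesis .
qed

lemma sum_cdeg_card: "(\<Sum>F | F \<subseteq> E \<and> card F = j. cdeg F) = card CC * (k choose j)"
proof -
  have "{Z. {} \<subseteq> Z \<and> Z \<subseteq> E \<and> card Z - card {} = j} = {F. F \<subseteq> E \<and> card F = j}" by auto
  moreover have "cdeg {} = card CC" by (simp add: cdeg_def)
  ultimately show ?thesis using sum_cdeg[of "{}" j] by simp
qed

text \<open>Summing over all sets of size below \<open>k\<close> instead of the flats only: a non-flat of
  size \<open>k - 1\<close> lies in exactly one member of \<open>CC\<close>.\<close>
lemma sum_sflats: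
  fixes g :: "'a set \<Rightarrow> int"
  shows "(\<Sum>Z | Z \<in> sflats \<and> P Z. g Z) =
    (\<Sum>Z | Z \<subseteq> E \<and> card Z < k \<and> P Z. g Z * (1 - (if Suc (card Z) = k then of_nat (cdeg Z) else 0)))"
proof -
  have fin: "finite {Z. Z \<subseteq> E \<and> card Z < k \<and> P Z}"
    using finE by (auto intro: finite_subset[of _ "Pow E"])
  have "cdeg Z = 0 \<or> cdeg Z = 1" if "Z \<subseteq> E" "Suc (card Z) = k" for Z
    using cdeg_le_1[OF that] by linarith
  then show ?thesis
    by (intro sum.mono_neutral_cong_left fin) (auto simp: sflats_def)
qed

text \<open>Compare with the uniform matroid, with q = k - 1 - |F|. The missing (k-1)-sets change
  the sum of the recursion by \<open>- (-1)^q * (q + 1) * cdeg F\<close>, the circuit-hyperplanes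
  above F add \<open>(-1)^q * q * cdeg F\<close>, and a single \<open>cdeg F\<close>
  survives.\<close>

lemma moebius_top:
  assumes F: "F \<in> sflats"
  shows "moebius (flats M) F E =
    (-1) ^ (k - card F) * (of_nat (n - card F - 1 choose (k - 1 - card F)) - of_nat (cdeg F))"
proof -
  define j where "j = card F"
  define q where "q = k - 1 - j"
  have F': "F \<subseteq> E" "j < k" "Suc j = k \<Longrightarrow> cdeg F = 0" using F by (auto simp: sflats_def j_def)
  have ps: "F \<subset> E" using F' k_le_n by (auto simp: j_def)
  have fF: "finite F" using F' finite_sub by auto
  have kj: "k - j = Suc q" using F' by (simp add: q_def)
  have jZ: "j \<le> card Z" if "F \<subseteq> Z" "Z \<subseteq> E" for Z
    using that finite_sub by (auto simp: j_def intro: card_mono)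
  have split: "{Z \<in> flats M. F \<subseteq> Z \<and> Z \<subset> E} = {Z \<in> sflats. F \<subseteq> Z} \<union> {C \<in> CC. F \<subseteq> C}"
  proof -
    have "Z \<subset> E" if "Z \<in> sflats" for Z using that k_le_n by (auto simp: sflats_def)
    moreover have "C \<subset> E" if "C \<in> CC" for C using that CC_subset ground_notin_CC by blast
    ultimately show ?thesis unfolding flats_iff by blast
  qed
  have set_eq: "{Z. Z \<subseteq> E \<and> card Z < k \<and> F \<subseteq> Z} = {Z. F \<subseteq> Z \<and> Z \<subseteq> E \<and> card Z - card F \<le> q}"
    using F' jZ by (auto simp: q_def j_def)
  have fin: "finite {Z. F \<subseteq> Z \<and> Z \<subseteq> E \<and> card Z - card F \<le> q}"
    using finE by (auto intro: finite_subset[of _ "Pow E"])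
  have top: "{Z \<in> {Z. F \<subseteq> Z \<and> Z \<subseteq> E \<and> card Z - card F \<le> q}. Suc (card Z) = k} =
      {Z. F \<subseteq> Z \<and> Z \<subseteq> E \<and> card Z - card F = q}"
  proof -
    have "Suc (card Z) = k \<longleftrightarrow> card Z - card F = q" if "F \<subseteq> Z" "Z \<subseteq> E" for Z
      using jZ[OF that] F'(2) unfolding q_def j_def by linarith
    then show ?thesis by auto
  qed
  have "(\<Sum>Z | Z \<in> sflats \<and> F \<subseteq> Z. moebius (flats M) F Z) =
      (\<Sum>Z | Z \<in> sflats \<and> F \<subseteq> Z. (-1) ^ (card Z - card F))"
    by (intro sum.cong refl) (simp add: moebius_sflats)
  also have "\<dots> = (\<Sum>Z | F \<subseteq> Z \<and> Z \<subseteq> E \<and> card Z - card F \<le> q. (-1) ^ (card Z - card F) *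
      (1 - (if Suc (card Z) = k then of_nat (cdeg Z) else 0)))"
    unfolding sum_sflats set_eq ..
  also have "\<dots> = (\<Sum>Z | F \<subseteq> Z \<and> Z \<subseteq> E \<and> card Z - card F \<le> q. (-1) ^ (card Z - card F)) -
      (\<Sum>Z | F \<subseteq> Z \<and> Z \<subseteq> E \<and> card Z - card F \<le> q. if Suc (card Z) = k then
        (-1) ^ q * of_nat (cdeg Z) else 0)"
    unfolding sum_subtractf[symmetric] using jZ
    by (intro sum.cong refl) (auto simp: algebra_simps q_def j_def)
  also have "(\<Sum>Z | F \<subseteq> Z \<and> Z \<subseteq> E \<and> card Z - card F \<le> q. if Suc (card Z) = k then
        (-1) ^ q * of_nat (cdeg Z) else 0) =
      (\<Sum>Z | F \<subseteq> Z \<and> Z \<subseteq> E \<and> card Z - card F = q. (-1) ^ q * int (cdeg Z))"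
    unfolding top[symmetric] by (rule sum.inter_filter[symmetric, OF fin])
  also have "\<dots> = (-1) ^ q * int (\<Sum>Z | F \<subseteq> Z \<and> Z \<subseteq> E \<and> card Z - card F = q. cdeg Z)"
    by (simp add: sum_distrib_left)
  also have "\<dots> = (-1) ^ q * (of_nat (cdeg F) * of_nat (k - j))"
    using sum_cdeg[OF F'(1), of q] kj by (simp add: j_def algebra_simps)
  finally have s1: "(\<Sum>Z | Z \<in> sflats \<and> F \<subseteq> Z. moebius (flats M) F Z) =
      (-1) ^ q * of_nat (n - j - 1 choose q) - (-1) ^ q * (of_nat (cdeg F) * of_nat (k - j))"
    by (simp add: alternating_interval_sum[OF finE ps] j_def)
  have s2: "(\<Sum>C | C \<in> CC \<and> F \<subseteq> C. moebius (flats M) F C) =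
      (-1) ^ q * (of_nat (cdeg F) * of_nat q)"
  proof (cases "Suc j = k")
    case True
    \<comment> \<open>A member of \<open>sflats\<close> of size k - 1 lies in no circuit-hyperplane;
      here q = 0, so the formula gives 0 too.\<close>
    then have "{C \<in> CC. F \<subseteq> C} = {}" using F' cdeg_eq_0[of F] by auto
    then have "(\<Sum>C | C \<in> CC \<and> F \<subseteq> C. moebius (flats M) F C) = 0" by (simp only: sum.empty)
    then show ?thesis using True by (simp add: q_def)
  next
    case False
    then have "(\<Sum>C | C \<in> CC \<and> F \<subseteq> C. moebius (flats M) F C) =
        (\<Sum>C | C \<in> CC \<and> F \<subseteq> C. (-1) ^ q * of_nat q)"
      using F'(2) by (intro sum.cong refl) (auto simp: moebius_CC q_def j_def)
    then show ?thesis by (simp add: cdeg_def)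
  qed
  have "moebius (flats M) F E = - ((\<Sum>Z | Z \<in> sflats \<and> F \<subseteq> Z. moebius (flats M) F Z) +
      (\<Sum>C | C \<in> CC \<and> F \<subseteq> C. moebius (flats M) F C))"
    unfolding moebius_rec[OF ps finE] split
    using sflats_CC_disjoint finite_sflats finCC by (subst sum.union_disjoint) auto
  also have "\<dots> = (-1) ^ Suc q * (of_nat (n - j - 1 choose q) - of_nat (cdeg F))"
    unfolding s1 s2 kj by (simp add: algebra_simps)
  finally show ?thesis using kj by (simp add: j_def q_def)
qed

lemma moebius_CC_top:
  assumes C: "C \<in> CC"
  shows "moebius (flats M) C E = - 1"
proof -
  have ps: "C \<subset> E" using C CC_subset ground_notin_CC by auto
  have "Z = C" if Z: "Z \<in> flats M" "C \<subseteq> Z" "Z \<subset> E" for Z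
  proof -
    have "card C \<le> card Z" using Z finite_sub by (intro card_mono) auto
    then have "Z \<notin> sflats" using CC_card[OF C] by (auto simp: sflats_def)
    then have "Z \<in> CC" using Z flats_iff by blast
    then show ?thesis
      using Z CC_card C finite_sub[OF CC_subset] card_subset_eq[of Z C] by auto
  qed
  moreover have "C \<in> flats M" using C by (simp add: flats_iff)
  ultimately have "{Z \<in> flats M. C \<subseteq> Z \<and> Z \<subset> E} = {C}" using ps by auto
  then show ?thesis by (simp add: moebius_rec[OF ps finE])
qed

section \<open>Contributions of the proper flats to the coefficients\<close>

definition ycoeff :: "nat \<Rightarrow> int" where
  "ycoeff i = of_nat (n choose (k - i)) * of_nat (n - k + i - 1 choose (i - 1)) -
    of_nat (card CC) * of_nat (k choose i)"

text \<open>Within \<open>sflats\<close>, exactly the flats of size k - i, which have corank i,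
  contribute to degree i. The signs of rank and Moebius value cancel, and \<open>ycoeff i\<close> is
  the sum of the absolute parts in \<open>moebius_top\<close>.\<close>

lemma coeff_sflats_sum:
  assumes Q: "\<And>F. F \<in> sflats \<Longrightarrow> Q (restriction M F) = 1" and i: "i \<le> k"
  shows "(-1) ^ k * coeff (\<Sum>F\<in>sflats. yterm Q M F) i = (if i = 0 then 0 else ycoeff i)"
proof -
  have "(-1) ^ k * coeff (yterm Q M F) i = (if card F = k - i \<and> i \<noteq> 0 then
      of_nat (n - (k - i) - 1 choose (i - 1)) - of_nat (cdeg F) else 0)" if F: "F \<in> sflats" for F
  proof -
    have lt: "card F < k" and sub: "F \<subseteq> E" using F by (auto simp: sflats_def)
    have fl: "F \<in> flats M" using F by (simp add: flats_iff)
    have "(-1) ^ k * coeff (yterm Q M F) i = (-1) ^ (k + card F) *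
        coeff (monom (moebius (flats M) F E) (k - card F)) i"
      using F lt sub by (simp add: yterm_eq[OF matroid fl] rank_small Q coeff_minus_one_power
          rk_eq power_add)
    also have "\<dots> = (if card F = k - i \<and> i \<noteq> 0 then (-1) ^ (k + card F) * (-1) ^ (k - card F) *
        (of_nat (n - (k - i) - 1 choose (i - 1)) - of_nat (cdeg F)) else 0)"
      using i lt by (auto simp: moebius_top[OF F])
    also have "(-1) ^ (k + card F) * (-1) ^ (k - card F) = (1 :: int)"
      using lt by (simp flip: power_add)
    finally show ?thesis by simp
  qed
  then have "(-1) ^ k * coeff (\<Sum>F\<in>sflats. yterm Q M F) i = (\<Sum>F\<in>sflats. if card F = k - i \<and> i \<noteq> 0 then
      of_nat (n - (k - i) - 1 choose (i - 1)) - of_nat (cdeg F) else 0)"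
    by (simp add: coeff_sum sum_distrib_left)
  also have "\<dots> = (if i = 0 then 0 else ycoeff i)"
  proof (cases "i = 0")
    case False
    then have lt: "k - i < k" using i by simp
    define b where "b = (n - (k - i) - 1 choose (i - 1))"
    have fin: "finite {F. F \<subseteq> E \<and> card F = k - i}"
      using finE by (auto intro: finite_subset[of _ "Pow E"])
    \<comment> \<open>A set of size k - i that is no flat forces i = 1; then b = 1 and the set lies
      in exactly one circuit-hyperplane. Its summand vanishes, so the sum may run over all sets of
      this size.\<close>
    have z: "int b - int (cdeg F) = 0" if "F \<subseteq> E" "card F = k - i" "F \<notin> sflats" for F
    proof -
      have s: "Suc (card F) = k" "cdeg F \<noteq> 0" using that lt by (auto simp: sflats_def)
      then have "i = 1" using that i False by linarith
      then show ?thesis using cdeg_le_1[OF that(1) s(1)] s(2) by (simp add: b_def)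
    qed
    have "(\<Sum>F\<in>sflats. if card F = k - i \<and> i \<noteq> 0 then int b - of_nat (cdeg F) else 0) =
        (\<Sum>F | F \<in> sflats \<and> card F = k - i. int b - of_nat (cdeg F))"
      using False by (simp add: sum.inter_filter[OF finite_sflats])
    also have "\<dots> = (\<Sum>F | F \<subseteq> E \<and> card F = k - i. int b - of_nat (cdeg F))"
    proof (rule sum.mono_neutral_left[OF fin])
      show "{F \<in> sflats. card F = k - i} \<subseteq> {F. F \<subseteq> E \<and> card F = k - i}"
        by (auto simp: sflats_def)
    qed (intro ballI z, auto)
    also have "\<dots> = of_nat (n choose (k - i)) * int b - int (\<Sum>F | F \<subseteq> E \<and> card F = k - i. cdeg F)"
      by (simp add: sum_subtractf n_subsets[OF finE])
    also have "\<dots> = ycoeff i"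
      using i k_le_n binomial_symmetric[OF i] by (simp add: sum_cdeg_card ycoeff_def b_def)
    finally show ?thesis using False unfolding b_def by simp
  qed simp
  finally show ?thesis .
qed

text \<open>A circuit-hyperplane has rank k - 1 and Moebius value -1 to the top. The signs cancel,
  and corank 1 shifts Q of the restriction by one degree.\<close>

lemma coeff_yterm_CC:
  assumes C: "C \<in> CC"
  shows "(-1) ^ k * coeff (yterm Q M C) i =
    (if i = 0 then 0 else coeff (Q (restriction M C)) (i - 1))"
proof -
  have fl: "C \<in> flats M" using C by (simp add: flats_iff)
  have y: "yterm Q M C = (-1) ^ (k - 1) * (monom (- 1) 1 * Q (restriction M C))"
    using k_pos by (simp add: yterm_eq[OF matroid fl] rank_CC[OF C] moebius_CC_top[OF C] rk_eq)
  have odd: "odd (k + (k - 1))" using k_pos by presburger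
  have "(-1) ^ k * coeff (yterm Q M C) i =
      (-1) ^ (k + (k - 1)) * coeff (monom (- 1) 1 * Q (restriction M C)) i"
    by (simp add: y coeff_minus_one_power power_add)
  also have "\<dots> = (if i = 0 then 0 else coeff (Q (restriction M C)) (i - 1))"
    using odd by (simp add: coeff_monom_mult)
  finally show ?thesis .
qed

lemma coeff_ytail:
  assumes Q: "\<And>F. F \<in> sflats \<Longrightarrow> Q (restriction M F) = 1" and i: "i \<le> k"
  shows "coeff ((-1) ^ k * ytail Q M) i =
    (if i = 0 then 0 else ycoeff i + (\<Sum>C\<in>CC. coeff (Q (restriction M C)) (i - 1)))"
proof -
  have "ytail Q M = (\<Sum>F\<in>sflats. yterm Q M F) + (\<Sum>C\<in>CC. yterm Q M C)"
    unfolding ytail_def proper_flats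
    by (rule sum.union_disjoint[OF finite_sflats finCC sflats_CC_disjoint])
  then have "coeff ((-1) ^ k * ytail Q M) i = (-1) ^ k * coeff (\<Sum>F\<in>sflats. yterm Q M F) i +
      (\<Sum>C\<in>CC. (-1) ^ k * coeff (yterm Q M C) i)"
    by (simp only: coeff_minus_one_power coeff_add coeff_sum distrib_left sum_distrib_left)
  also have "(\<Sum>C\<in>CC. (-1) ^ k * coeff (yterm Q M C) i) =
      (\<Sum>C\<in>CC. if i = 0 then 0 else coeff (Q (restriction M C)) (i - 1))"
    by (intro sum.cong refl coeff_yterm_CC)
  finally show ?thesis
    using coeff_sflats_sum[of Q i, OF Q i] by (cases "i = 0") simp_all
qed

text \<open>Restrictions to nonempty proper flats are again instances of the locale, with no
  circuit-hyperplanes. Here they are Boolean; the empty flat, of rank 0, is treated in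
  \<open>inverse_KL_empty\<close>.\<close>

lemma restriction_sflats:
  assumes F: "F \<in> sflats" "F \<noteq> {}"
  shows "sparse_matroid (restriction M F) (card F) {}"
proof (rule sparse_matroid.intro)
  have F': "F \<subseteq> E" "card F < k" using F by (auto simp: sflats_def)
  show "is_matroid (restriction M F)" by (rule matroid_restriction[OF matroid F'(1)])
  show "I \<in> indep (restriction M F) \<longleftrightarrow> I \<subseteq> ground (restriction M F) \<and> card I \<le> card F \<and> I \<notin> {}" for I
    using F' finite_sub[OF F'(1)] CC_card[of I] card_mono[of F I]
    by (auto simp: restriction_def indep_iff)
  show "1 \<le> card F" using F finite_sub[OF F'(1)] by (simp add: Suc_le_eq card_gt_0_iff)
  show "rk (restriction M F) = card F" by (simp add: rk_restriction rank_small[OF F'])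
qed auto

text \<open>The restriction is the uniform matroid of rank k - 1 on k elements.\<close>

lemma restriction_CC:
  assumes C: "C \<in> CC"
  shows "sparse_matroid (restriction M C) (k - 1) {}"
proof (rule sparse_matroid.intro)
  have C': "C \<subseteq> E" "card C = k" "finite C" using C CC_subset CC_card finite_sub by auto
  show "is_matroid (restriction M C)" by (rule matroid_restriction[OF matroid C'(1)])
  have "card I \<le> k - 1" if "I \<subseteq> C" "I \<notin> CC" for I
  proof -
    have "I \<subset> C" using that C by auto
    from psubset_card_mono[OF C'(3) this] show ?thesis using C'(2) by linarith
  qed
  moreover have "I \<notin> CC" if "card I \<le> k - 1" for I using that CC_card[of I] k_pos by auto
  ultimately show "I \<in> indep (restriction M C) \<longleftrightarrow>
      I \<subseteq> ground (restriction M C) \<and> card I \<le> k - 1 \<and> I \<notin> {}" for I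
    using C' by (auto simp: restriction_def indep_iff)
  show "1 \<le> k - 1" using CC_k C by fastforce
  show "rk (restriction M C) = k - 1" by (simp add: rk_restriction rank_CC[OF C])
qed auto

lemma coeff_inverse_KL_high: "k \<le> 2 * i \<Longrightarrow> coeff (inverse_KL M) i = 0"
  using admissible_coeff[OF admissible_inverse_KL matroid loopless, of i] k_pos rk_eq by auto

lemma coeff_inverse_Z_loopless:
  "coeff (inverse_Z_loopless M) i = coeff (inverse_KL M) i + coeff ((-1) ^ k * ytail inverse_KL M) i"
  by (simp add: inverse_Z_loopless_eq_ytail[OF matroid] rk_eq)

text \<open>Compare the coefficients of the palindromic Y in degrees i and k - i; in the latter the
  polynomial Q has no term.\<close>

lemma coeff_inverse_KL_low:
  assumes "2 * i < k"
  shows "coeff (inverse_KL M) i = coeff ((-1) ^ k * ytail inverse_KL M) (k - i) -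
    coeff ((-1) ^ k * ytail inverse_KL M) i"
  using inverse_Z_loopless_palindromic[OF matroid loopless, of i] assms
    coeff_inverse_KL_high[of "k - i"] by (simp add: coeff_inverse_Z_loopless rk_eq)

lemma inverse_KL_empty:
  "inverse_KL (restriction M {}) = 1"
proof -
  have "rk (restriction M {}) = 0" using rank_small[of "{}"] k_pos by (simp add: rk_restriction)
  then show ?thesis
    using admissible_inverse_KL[unfolded admissible_def, rule_format, of "restriction M {}"]
      matroid_restriction[OF matroid, of "{}"] loopless_restriction[OF loopless, of "{}"] by simp
qed

end

text \<open>By induction Q = 1 on all proper flats, so the tail has the coefficients
  \<open>k choose i\<close> except that its constant term is 0. Only the constant 1 is missing for
  symmetry.\<close>

lemma inverse_KL_boolean:
  assumes "sparse_matroid M k {}" "card (ground M) = k"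
  shows "inverse_KL M = 1"
  using assms
proof (induction k arbitrary: M rule: less_induct)
  case (less k)
  interpret sparse_matroid M k "{}" by (rule less.prems(1))
  have Q: "inverse_KL (restriction M F) = 1" if F: "F \<in> sflats" for F
  proof (cases "F = {}")
    case False
    then show ?thesis
      using less.IH[OF _ restriction_sflats[OF F]] F by (auto simp: sflats_def)
  qed (simp add: inverse_KL_empty)
  have t: "coeff ((-1) ^ k * ytail inverse_KL M) i = (if i = 0 then 0 else of_nat (k choose i))"
    if "i \<le> k" for i
    using coeff_ytail[of inverse_KL i, OF Q that] less.prems(2) binomial_symmetric[OF that] that
    by (simp add: ycoeff_def)
  show ?case
  proof (rule poly_eqI)
    fix i
    show "coeff (inverse_KL M) i = coeff 1 i"
    proof (cases "2 * i < k")
      case True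
      then show ?thesis
        using coeff_inverse_KL_low[OF True] t[of i] t[of "k - i"] binomial_symmetric[of i k] k_pos
        by (auto simp: coeff_1)
    next
      case False
      then show ?thesis using coeff_inverse_KL_high[of i] k_pos by (auto simp: coeff_1)
    qed
  qed
qed

context sparse_matroid
begin

lemma inverse_KL_sflats:
  assumes F: "F \<in> sflats"
  shows "inverse_KL (restriction M F) = 1"
proof (cases "F = {}")
  case False
  then show ?thesis using inverse_KL_boolean[OF restriction_sflats[OF F]] by simp
qed (simp add: inverse_KL_empty)

lemmas coeff_tail = coeff_ytail[where Q = inverse_KL, OF inverse_KL_sflats]

end

text \<open>The degree m - 1 is the largest one allowed in rank 2m - 1. The tail coefficients in
  degrees m and m - 1 differ by \<open>m * (2m choose (m-1)) - (m-1) * (2m choose m)\<close>, which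
  absorption reduces to this Catalan number.\<close>

lemma coeff_inverse_KL_uniform_corank_1:
  assumes "sparse_matroid M (2 * m - 1) {}" "card (ground M) = 2 * m" "m \<ge> 1"
  shows "coeff (inverse_KL M) (m - 1) = int (2 * m choose m) - int (2 * m choose (m - 1))"
proof -
  interpret sparse_matroid M "2 * m - 1" "{}" by fact
  have m: "2 * m - 1 - (m - 1) = m" "2 * m - 1 - m = m - 1" using assms by auto
  obtain l where l: "m = Suc l" using assms(3) by (cases m) auto
  have hi: "coeff ((-1) ^ (2 * m - 1) * ytail inverse_KL M) m = int (2 * m choose (m - 1)) * int m"
    using coeff_tail[of m, unfolded ycoeff_def] assms by (simp add: m l)
  have lo: "coeff ((-1) ^ (2 * m - 1) * ytail inverse_KL M) (m - 1) = int (2 * m choose m) * int (m - 1)"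
  \<comment> \<open>For m = 1 the index is 0, where the tail vanishes and \<open>ycoeff\<close> does
    not describe it.\<close>
  proof (cases l)
    case (Suc l')
    then show ?thesis
      using coeff_tail[of "m - 1", unfolded ycoeff_def] assms by (simp add: m l)
  qed (use coeff_tail[of 0] l in simp)
  have "Suc (m - 1) * (2 * m choose Suc (m - 1)) = (2 * m choose (m - 1)) * (2 * m - (m - 1))"
    using binomial_absorb_comp[of "2 * m" "m - 1"] binomial_absorption[of "m - 1" "2 * m"]
    by (simp only: mult.commute)
  moreover have "Suc (m - 1) = m" "2 * m - (m - 1) = m + 1" using assms by auto
  ultimately have "m * (2 * m choose m) = (2 * m choose (m - 1)) * (m + 1)" by (simp only:)
  from arg_cong[OF this, of int]
  have "int m * int (2 * m choose m) = int (2 * m choose (m - 1)) * (int m + 1)"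
    by (simp only: of_nat_mult of_nat_add of_nat_1)
  then show ?thesis
    using coeff_inverse_KL_low[of "m - 1"] hi lo m l by (simp add: algebra_simps)
qed

section \<open>Upper half of the coefficients and bounds on the number of
  circuit-hyperplanes\<close>

context sparse_matroid
begin

text \<open>Above the middle, i exceeds the degree of Q of M, and i - 1 exceeds the degree of Q of
  each circuit-hyperplane, whose rank is k - 1.\<close>

lemma coeff_inverse_Z_high:
  assumes "k < 2 * i" "i \<le> k"
  shows "coeff (inverse_Z_loopless M) i = ycoeff i"
proof -
  have "coeff (inverse_KL (restriction M C)) (i - 1) = 0" if C: "C \<in> CC" for C
    using sparse_matroid.coeff_inverse_KL_high[OF restriction_CC[OF C], of "i - 1"] assms by simp
  then show ?thesis
    using assms by (simp add: coeff_inverse_Z_loopless coeff_inverse_KL_high coeff_tail)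
qed

text \<open>Each circuit-hyperplane contributes \<open>- (k choose i)\<close> through
  \<open>ycoeff\<close> and the Catalan number \<open>(k choose i) - (k choose (i - 1))\<close>
  through its own Q.\<close>

lemma coeff_inverse_Z_middle:
  assumes "k = 2 * i"
  shows "coeff (inverse_Z_loopless M) i =
    of_nat (n choose i) * of_nat (n - i - 1 choose (i - 1)) - of_nat (card CC) * of_nat (k choose (i - 1))"
proof -
  have i: "i \<ge> 1" using assms k_pos by auto
  have *: "coeff (inverse_KL (restriction M C)) (i - 1) = int (k choose i) - int (k choose (i - 1))"
    if C: "C \<in> CC" for C
    using coeff_inverse_KL_uniform_corank_1[OF _ _ i, of "restriction M C"] restriction_CC[OF C]
      CC_card[OF C] assms by simp
  have "(\<Sum>C\<in>CC. coeff (inverse_KL (restriction M C)) (i - 1)) =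
      (\<Sum>C\<in>CC. int (k choose i) - int (k choose (i - 1)))"
    by (intro sum.cong refl *)
  then have "coeff (inverse_Z_loopless M) i =
      ycoeff i + of_nat (card CC) * (int (k choose i) - int (k choose (i - 1)))"
  proof -
    have "i \<le> k" "k \<le> 2 * i" "i \<noteq> 0" using assms i by auto
    with \<open>(\<Sum>C\<in>CC. _ C) = _\<close> show ?thesis
      by (simp add: coeff_inverse_Z_loopless coeff_inverse_KL_high coeff_tail)
  qed
  moreover have "n - k + i - 1 = n - i - 1" "k - i = i" using assms k_le_n by auto
  ultimately show ?thesis by (simp add: ycoeff_def algebra_simps)
qed

text \<open>Counting (k-1)-sets by \<open>cdeg_le_1\<close> gives
  \<open>card CC * k \<le> n choose (k - 1)\<close>; absorption turns this into a bound by
  \<open>n choose k\<close>.\<close>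

lemma card_CC_corank: "card CC * (n - k + 1) \<le> n choose k"
proof -
  have "card CC * (k choose (k - 1)) = (\<Sum>F | F \<subseteq> E \<and> card F = k - 1. cdeg F)"
    by (rule sum_cdeg_card[symmetric])
  also have "\<dots> \<le> (\<Sum>F | F \<subseteq> E \<and> card F = k - 1. 1)"
    using k_pos by (intro sum_mono cdeg_le_1) auto
  also have "\<dots> = n choose (k - 1)" by (simp add: n_subsets[OF finE])
  finally have "card CC * k \<le> n choose (k - 1)"
    using k_pos binomial_symmetric[of "k - 1" k] by simp
  then have "card CC * k * (n - k + 1) \<le> (n choose (k - 1)) * (n - (k - 1))"
    using k_pos k_le_n by (intro mult_mono) auto
  also have "\<dots> = k * (n choose k)"
    using binomial_absorb_comp[of n "k - 1"] binomial_absorption[of "k - 1" n] k_pos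
    by (simp add: mult.commute)
  finally have "k * (card CC * (n - k + 1)) \<le> k * (n choose k)" by (simp only: mult_ac)
  then show ?thesis by (rule mult_left_le_imp_le) (use k_pos in simp)
qed

text \<open>A (k+1)-set contains at most one circuit-hyperplane, and each of these lies in n - k
  such sets. Absorption and cancelling n - k give the claim; for n = k there are no
  circuit-hyperplanes.\<close>

lemma card_CC_rank: "card CC * (k + 1) \<le> n choose k"
proof (cases "n = k")
  case True
  then have "C = E" if "C \<in> CC" for C
    using that CC_subset CC_card finE by (intro card_subset_eq) auto
  then have "CC = {}" using ground_notin_CC by auto
  then show ?thesis by simp
next
  case False
  let ?S = "{A. A \<subseteq> E \<and> card A = Suc k}"
  have fS: "finite ?S" using finE by (auto intro: finite_subset[of _ "Pow E"])
  have le1: "card {C \<in> CC. C \<subseteq> A} \<le> 1" if A: "A \<in> ?S" for A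
  proof -
    have fA: "finite A" using A finite_sub by auto
    have "C = C'" if C: "C \<in> CC" "C \<subseteq> A" "C' \<in> CC" "C' \<subseteq> A" for C C'
    proof (rule ccontr)
      assume "C \<noteq> C'"
      with C have "card (C \<inter> C') + 2 \<le> k" by (intro CC_inter)
      moreover have "card (C \<union> C') \<le> Suc k"
        using card_mono[OF fA, of "C \<union> C'"] C A by auto
      moreover have "card (C \<union> C') + card (C \<inter> C') = k + k"
        using card_Un_Int[of C C'] C CC_card finite_subset[OF _ fA] by auto
      ultimately show False by linarith
    qed
    then show ?thesis by (auto simp: card_le_Suc0_iff_eq finCC)
  qed
  have "card CC * (n - k) = (\<Sum>C\<in>CC. \<Sum>A | A \<in> ?S \<and> C \<subseteq> A. 1)"
  proof -
    have "card {A \<in> ?S. C \<subseteq> A} = n - k" if C: "C \<in> CC" for C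
    proof -
      have "{A \<in> ?S. C \<subseteq> A} = {Z. C \<subseteq> Z \<and> Z \<subseteq> E \<and> card Z - card C = 1}"
        using CC_card[OF C] by auto
      then show ?thesis
        using card_interval[OF finE CC_subset[OF C], of 1] CC_card[OF C] by simp
    qed
    then show ?thesis by simp
  qed
  also have "\<dots> = (\<Sum>A\<in>?S. \<Sum>C | C \<in> CC \<and> C \<subseteq> A. 1)"
    by (rule sum.swap_restrict[OF finCC fS])
  also have "\<dots> \<le> (\<Sum>A\<in>?S. 1)" using le1 by (intro sum_mono) simp
  also have "\<dots> = n choose (Suc k)" by (simp add: n_subsets[OF finE])
  finally have "card CC * (n - k) * Suc k \<le> (n choose Suc k) * Suc k" by (rule mult_right_mono) simp
  also have "\<dots> = (n choose k) * (n - k)"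
    using binomial_absorb_comp[of n k] binomial_absorption[of k n] by (simp add: mult.commute)
  finally have "(n - k) * (card CC * (k + 1)) \<le> (n - k) * (n choose k)"
    by (simp only: mult_ac Suc_eq_plus1)
  then show ?thesis by (rule mult_left_le_imp_le) (use False k_le_n in simp)
qed

end

section \<open>From sparse paving matroids to circuit-hyperplanes\<close>

lemma dependent_contains_circuit:
  assumes "D \<subseteq> ground M" "finite D" "D \<notin> indep M"
  obtains C where "C \<in> circuits M" "C \<subseteq> D"
proof -
  let ?S = "{C. C \<subseteq> D \<and> C \<notin> indep M}"
  have "finite ?S" "?S \<noteq> {}" using assms by (auto intro: finite_subset[of _ "Pow D"])
  then obtain C where C: "C \<in> ?S" "\<And>B. B \<in> ?S \<Longrightarrow> B \<subseteq> C \<Longrightarrow> C = B"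
    using finite_has_minimal[of ?S] by auto
  have "B \<in> indep M" if "B \<subset> C" for B using C that by blast
  then have "C \<in> circuits M" using C(1) assms(1) by (auto simp: circuits_def)
  then show ?thesis using that C by auto
qed

lemma paving_indep:
  assumes "paving M" "I \<subseteq> ground M" "finite I" "card I < rk M"
  shows "I \<in> indep M"
proof (rule ccontr)
  assume "I \<notin> indep M"
  then obtain C where C: "C \<in> circuits M" "C \<subseteq> I"
    using dependent_contains_circuit[OF assms(2,3)] by blast
  then have "rk M \<le> card C" "card C \<le> card I"
    using assms by (auto simp: paving_def intro: card_mono)
  then show False using assms by simp
qed

lemma basis_card:
  assumes M: "is_matroid M"
  shows "bases M = {B \<in> indep M. card B = rk M}"
proof (intro equalityI subsetI)
  fix B assume B: "B \<in> bases M"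
  then have I: "B \<in> indep M" "B \<subseteq> ground M"
    using indep_subset_ground[OF M] by (auto simp: bases_def)
  obtain J where "J \<in> indep M" "B \<subseteq> J" "card J = rank_of M (ground M)"
    using indep_extend[OF M I] by blast
  then show "B \<in> {B \<in> indep M. card B = rk M}"
    using B by (auto simp: bases_def rk_def)
next
  fix B assume B: "B \<in> {B \<in> indep M. card B = rk M}"
  have "I = B" if I: "I \<in> indep M" "B \<subseteq> I" for I
  proof -
    have "card I \<le> card B"
      using indep_card_le_rank[OF M I(1) indep_subset_ground[OF M I(1)]] B by (simp add: rk_def)
    then show ?thesis using I card_seteq[OF indep_finite[OF M I(1)], of B] by simp
  qed
  then show "B \<in> bases M" using B by (auto simp: bases_def)
qed

lemma rk_dual:
  assumes M: "is_matroid M"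
  shows "rk (dual M) = card (ground M) - rk M"
proof -
  let ?S = "{I. \<exists>B\<in>bases M. I \<subseteq> ground M - B}"
  have c: "card (ground M - B) = card (ground M) - rk M" if "B \<in> bases M" for B
    using that indep_subset_ground[OF M] indep_finite[OF M]
    by (auto simp: basis_card[OF M] card_Diff_subset)
  have fin: "finite ?S"
    using matroid_finite[OF M] by (auto intro: finite_subset[of _ "Pow (ground M)"])
  obtain B where B: "B \<in> bases M"
    using rank_attained[OF M, of "ground M"] by (auto simp: basis_card[OF M] rk_def)
  have eq: "{I \<in> indep (dual M). I \<subseteq> ground (dual M)} = ?S" by (auto simp: dual_def)
  show ?thesis
    unfolding rk_def[of "dual M"] rank_of_def eq
  proof (rule Max_eqI)
    show "finite (card ` ?S)" using fin by simp
    show "card (ground M) - rk M \<in> card ` ?S"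
      using B c[OF B] by (intro image_eqI[of _ _ "ground M - B"]) auto
    fix y assume "y \<in> card ` ?S"
    then obtain I B' where "B' \<in> bases M" "I \<subseteq> ground M - B'" "y = card I" by auto
    then show "y \<le> card (ground M) - rk M"
      using c[of B'] card_mono[of "ground M - B'" I] matroid_finite[OF M] by simp
  qed
qed

text \<open>Paving makes all sets of size below k independent. Paving of the dual makes every
  (k+1)-set contain a basis, so two dependent k-sets cannot meet in k - 1 elements.\<close>

lemma sparse_matroid_of_sparse_paving:
  assumes M: "is_matroid M" and sp: "sparse_paving M" and k: "rk M = k" "2 \<le> k"
  shows "sparse_matroid M k {C. C \<subseteq> ground M \<and> card C = k \<and> C \<notin> indep M}"
proof (rule sparse_matroid.intro)
  let ?E = "ground M"
  let ?CC = "{C. C \<subseteq> ?E \<and> card C = k \<and> C \<notin> indep M}"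
  have fE: "finite ?E" by (rule matroid_finite[OF M])
  have pav: "paving M" "paving (dual M)" using sp by (auto simp: sparse_paving_def)
  have small: "I \<in> indep M" if "I \<subseteq> ?E" "card I < k" for I
    using that k finite_subset[OF that(1) fE] by (intro paving_indep[OF pav(1)]) auto
  have le: "card I \<le> k" if "I \<in> indep M" for I
    using indep_card_le_rank[OF M that indep_subset_ground[OF M that]] k by (simp add: rk_def)
  show "I \<in> indep M \<longleftrightarrow> I \<subseteq> ?E \<and> card I \<le> k \<and> I \<notin> ?CC" for I
    using indep_subset_ground[OF M] le small[of I] by (cases "card I = k") auto
  fix C C' assume C: "C \<in> ?CC" "C' \<in> ?CC" "C \<noteq> C'"
  have fC: "finite C" "finite C'" using C fE finite_subset by auto
  show "card (C \<inter> C') + 2 \<le> k"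
  proof (rule ccontr)
    assume neg: "\<not> ?thesis"
    have "\<not> C \<subseteq> C'"
    proof
      assume "C \<subseteq> C'"
      then have "C = C'" using card_subset_eq[OF fC(2)] C by simp
      then show False using C(3) by contradiction
    qed
    then have "C \<inter> C' \<subset> C" by blast
    from psubset_card_mono[OF fC(1) this] have "card (C \<inter> C') < k" using C by simp
    then have i: "card (C \<inter> C') = k - 1" using neg by linarith
    then have I: "C \<inter> C' \<in> indep M" using C k by (intro small) auto
    have cu: "card (C \<union> C') = Suc k"
      using card_Un_Int[OF fC] C i k by simp
    have sub: "C \<union> C' \<subseteq> ?E" using C by simp
    \<comment> \<open>The complement has n - k - 1 elements, one fewer than the rank of the
      dual.\<close>
    have "?E - (C \<union> C') \<in> indep (dual M)"
    proof (rule paving_indep[OF pav(2)])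
      have "k \<le> card ?E" using C fE card_mono by blast
      moreover have "Suc k \<le> card ?E" using cu card_mono[OF fE sub] by simp
      ultimately show "card (?E - (C \<union> C')) < rk (dual M)"
        using cu sub fC k by (simp add: rk_dual[OF M] card_Diff_subset)
    qed (use fE in \<open>auto simp: dual_def\<close>)
    then obtain B where B: "B \<in> bases M" "?E - (C \<union> C') \<subseteq> ?E - B" by (auto simp: dual_def)
    have B': "B \<in> indep M" "card B = k" "B \<subseteq> C \<union> C'"
      using B indep_subset_ground[OF M, of B] k by (auto simp: basis_card[OF M])
    text \<open>Augmenting \<open>C \<inter> C'\<close> from a basis inside \<open>C \<union> C'\<close> would make \<open>C\<close> or \<open>C'\<close> independent.\<close>
    obtain x where x: "x \<in> B - C \<inter> C'" "insert x (C \<inter> C') \<in> indep M"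
      using indep_augment[OF M I B'(1)] i B' k by auto
    have cx: "card (insert x (C \<inter> C')) = k" using x(1) fC i k by auto
    have "insert x (C \<inter> C') = C \<or> insert x (C \<inter> C') = C'"
    proof (cases "x \<in> C")
      case True
      then show ?thesis using cx C fC by (intro disjI1 card_subset_eq) auto
    next
      case False
      then have "x \<in> C'" using x B' by auto
      then show ?thesis using cx C fC by (intro disjI2 card_subset_eq) auto
    qed
    then show False using x C by auto
  qed
qed (use assms in auto)

section \<open>Log-concavity of the coefficient sequence\<close>

lemma divide_le_divideI:
  fixes a b x y :: real
  assumes "a * y \<le> b * x" "x > 0" "y > 0"
  shows "a / x \<le> b / y"
  using assms by (simp add: divide_simps mult.commute)

text \<open>For k = 2m + 1 this compares f(m - 1) with f(m); the weights m and m + 2 come from the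
  ratio of \<open>k choose m\<close> to \<open>k choose (m - 1)\<close>. The bound on l enters as N
  d / (d + 1) \<le> N - l.\<close>

lemma middle_odd_ineq:
  fixes m d N l :: real
  assumes m: "m \<ge> 1" and d: "d \<ge> 0" and N: "N > 0" and l: "l * (d + 1) \<le> N"
  shows "m * (N * (1 - d / (m + 2 + d)) - l) \<le> (m + 2) * (N * (1 - d / (m + 1 + d)) - l)"
proof -
  define u where "u = m + 1 + d"
  have u: "u > 0" and m': "m \<ge> 0" using m d by (auto simp: u_def)
  have du: "d + 1 = u - m" by (simp add: u_def)
  have "(2 * u + m + 2) * (d + 1) \<le> 2 * (u * (u + 1))"
    unfolding du using u m by (simp add: algebra_simps)
  then have "(2 * u + m + 2) / (u * (u + 1)) \<le> 2 / (d + 1)"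
    using u d by (intro divide_le_divideI) auto
  moreover have "(m + 2) / u - m / (u + 1) = (2 * u + m + 2) / (u * (u + 1))"
    using u by (simp add: field_simps)
  ultimately have "N * d * ((m + 2) / u - m / (u + 1)) \<le> N * d * (2 / (d + 1))"
    using N d by (intro mult_left_mono) auto
  also have "\<dots> = 2 * (N - N / (d + 1))" using d by (simp add: field_simps)
  also have "\<dots> \<le> 2 * (N - l)" using l d by (simp add: field_simps)
  finally have "N * d * ((m + 2) / u - m / (u + 1)) \<le> 2 * (N - l)" .
  then show ?thesis unfolding u_def by (simp add: algebra_simps)
qed

text \<open>The same for k = 2m, with ratio (m + 1) / m. The Catalan correction l / (m + 1) makes l
  cancel completely.\<close>

lemma middle_even_ineq:
  fixes m d N l :: real
  assumes m: "m \<ge> 1" and d: "d \<ge> 0" and N: "N > 0"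
  shows "m * (N * (1 - d / (m + 1 + d)) - l) \<le> (m + 1) * (N * (1 - d / (m + d)) - l + l / (m + 1))"
proof -
  define u where "u = m + d"
  have u: "u > 0" using m d by (auto simp: u_def)
  have du: "d = u - m" by (simp add: u_def)
  have "d * (u + m + 1) \<le> u * (u + 1)"
    unfolding du using m by (simp add: algebra_simps)
  then have "d * (u + m + 1) / (u * (u + 1)) \<le> 1" using u by simp
  moreover have "d * ((m + 1) / u - m / (u + 1)) = d * (u + m + 1) / (u * (u + 1))"
    using u by (simp add: field_simps)
  ultimately have "N * (d * ((m + 1) / u - m / (u + 1))) \<le> N * 1"
    using N by (intro mult_left_mono) auto
  moreover have "(m + 1) * (N * (1 - d / u) - l + l / (m + 1)) - m * (N * (1 - d / (u + 1)) - l) =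
      N - N * (d * ((m + 1) / u - m / (u + 1)))"
  proof -
    have "(m + 1) * (l / (m + 1)) = l" using m by simp
    then show ?thesis by (simp add: algebra_simps)
  qed
  ultimately show ?thesis unfolding u_def by (simp add: algebra_simps)
qed

text \<open>For k = 2m this is log-concavity at m - 1 after division by the binomials. With g = f(m
  - 1) and \<delta> = f(m - 1) - f(m), concavity gives f(m - 2) \<le> g + \<delta>. The correction l
  / (m + 1) is absorbed because l and \<delta> are at most g.\<close>

lemma middle_log_concave_ineq:
  fixes m d N l :: real
  assumes m: "m \<ge> 2" and d: "d \<ge> 0" and N: "N > 0" and l: "l \<ge> 0"
    and ld: "l * (d + 1) \<le> N" and lk: "l * (2 * m + 1) \<le> N"
    and pos: "0 \<le> N * (1 - d / (m + d)) - l + l / (m + 1)"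
  shows "(m\<^sup>2 - 1) * ((N * (1 - d / (m + 2 + d)) - l) * (N * (1 - d / (m + d)) - l + l / (m + 1)))
    \<le> m * (m + 2) * (N * (1 - d / (m + 1 + d)) - l)\<^sup>2"
proof -
  define v where "v = m + 1 + d"
  define g where "g = N * (1 - d / v) - l"
  define \<delta> where "\<delta> = N * (d / (v - 1) - d / v)"
  have v: "v > 1" and v1: "m + d = v - 1" "m + 2 + d = v + 1" using m d by (auto simp: v_def)
  \<comment> \<open>The two bounds on l combine since 2v + 1 = 2(d + 1) + (2m + 1); then 3 \<le> m +
    1 is used, and l \<le> g follows.\<close>
  have "2 * l * v \<le> 2 * (l * (d + 1)) + l * (2 * m + 1)"
    using l by (simp add: v_def algebra_simps)
  also have "\<dots> \<le> 3 * N" using ld lk by simp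
  also have "\<dots> \<le> (m + 1) * N" using m N by (intro mult_right_mono) auto
  finally have lv: "2 * l \<le> N * (m + 1) / v" using v by (simp add: field_simps)
  have "N * (1 - d / v) = N * (m + 1) / v" using v by (simp add: v_def field_simps)
  then have g2: "N * (m + 1) / v = g + l" by (simp add: g_def)
  have lg: "l \<le> g" using lv g2 by simp
  have "d / (v - 1) \<le> 1" using v m by (simp add: v_def)
  have "\<delta> = N / v * (d / (v - 1))" using v by (simp add: \<delta>_def field_simps)
  also have "\<dots> \<le> N / v * 1"
    using \<open>d / (v - 1) \<le> 1\<close> N v by (intro mult_left_mono) auto
  also have "\<dots> \<le> N * (m + 1) / v / 2" using N v m by (simp add: field_simps)
  also have "\<dots> \<le> g" using g2 lg by simp
  finally have dg: "\<delta> \<le> g" .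
  have "1 / v - 1 / (v + 1) \<le> 1 / (v - 1) - 1 / v"
    using v by (simp add: divide_simps)
  then have "N * d * (1 / v - 1 / (v + 1)) \<le> N * d * (1 / (v - 1) - 1 / v)"
    using N d by (intro mult_left_mono) auto
  then have f2: "N * (1 - d / (v + 1)) - l \<le> g + \<delta>"
    by (simp add: g_def \<delta>_def algebra_simps)
  have f0: "N * (1 - d / (v - 1)) - l + l / (m + 1) = g - \<delta> + l / (m + 1)"
    by (simp add: g_def \<delta>_def algebra_simps)
  have m1: "0 \<le> m\<^sup>2 - 1" using m one_le_power[of m 2] by simp
  have g0: "0 \<le> g" using l lg by simp
  have "(m\<^sup>2 - 1) * ((N * (1 - d / (v + 1)) - l) * (g - \<delta> + l / (m + 1))) \<le>
      (m\<^sup>2 - 1) * ((g + \<delta>) * (g - \<delta> + l / (m + 1)))"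
    using f2 pos m1 unfolding v1 f0 by (intro mult_left_mono mult_right_mono)
  also have "\<dots> = (m\<^sup>2 - 1) * (g\<^sup>2 - \<delta>\<^sup>2) + (m - 1) * ((g + \<delta>) * l)"
  proof -
    have 1: "(m\<^sup>2 - 1) * (l / (m + 1)) = (m - 1) * l"
      using m by (simp add: power2_eq_square field_simps)
    have 2: "(m\<^sup>2 - 1) * ((g + \<delta>) * (g - \<delta> + l / (m + 1))) =
        (m\<^sup>2 - 1) * (g\<^sup>2 - \<delta>\<^sup>2) + (g + \<delta>) * ((m\<^sup>2 - 1) * (l / (m + 1)))"
      by (simp add: power2_eq_square algebra_simps)
    show ?thesis unfolding 2 1 by (simp only: mult_ac)
  qed
  also have "\<dots> \<le> (m\<^sup>2 - 1) * g\<^sup>2 + (m - 1) * (2 * g * g)"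
    using m1 m dg lg g0 l by (intro add_mono mult_left_mono mult_mono) auto
  also have "\<dots> = (m * (m + 2) - 3) * g\<^sup>2" by (simp add: power2_eq_square algebra_simps)
  also have "\<dots> \<le> m * (m + 2) * g\<^sup>2" by (intro mult_right_mono) auto
  finally show ?thesis unfolding v1 v_def[symmetric] g_def[symmetric] f0 .
qed

lemma real_binomial_step:
  assumes "j < k"
  shows "real (j + 1) * real (k choose (j + 1)) = (real k - real j) * real (k choose j)"
proof -
  have "Suc j * (k choose Suc j) = (k - j) * (k choose j)"
    using binomial_absorb_comp[of k j] binomial_absorption[of j k] by simp
  from arg_cong[OF this, of real] show ?thesis
    using assms by (simp only: of_nat_mult of_nat_diff less_imp_le Suc_eq_plus1)
qed

lemma binomial_log_concave:
  assumes "j + 1 < k"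
  shows "real (k choose j) * real (k choose (j + 2)) \<le> (real (k choose (j + 1)))\<^sup>2"
proof -
  let ?C = "real (k choose (j + 1))"
  have 1: "(real j + 1) * ?C = (real k - real j) * real (k choose j)"
    using real_binomial_step[of j k] assms by (simp add: add.commute)
  have 2: "(real j + 2) * real (k choose (j + 2)) = (real k - real j - 1) * ?C"
    using real_binomial_step[of "j + 1" k] assms by (simp add: algebra_simps)
  have "real (j + 1) < real k" using assms by (simp only: of_nat_less_iff)
  then have k: "real j + 1 < real k" by simp
  have "((real k - real j) * (real j + 2)) * (real (k choose j) * real (k choose (j + 2))) =
      ((real k - real j) * real (k choose j)) * ((real j + 2) * real (k choose (j + 2)))"
    by (simp only: mult_ac)
  also have "\<dots> = ((real j + 1) * (real k - real j - 1)) * ?C\<^sup>2"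
    unfolding 1[symmetric] 2 by (simp only: mult_ac power2_eq_square)
  also have "\<dots> \<le> ((real k - real j) * (real j + 2)) * ?C\<^sup>2"
    using k by (intro mult_right_mono) (auto simp: algebra_simps)
  finally show ?thesis using k by (simp add: mult_le_cancel_left_pos)
qed

text \<open>\<open>N\<close> and \<open>l\<close> stand for the number of \<open>k\<close>-subsets and of dependent \<open>k\<close>-subsets
  of a set of size \<open>k + d\<close>.\<close>
locale sparse_coefficients =
  fixes k d :: nat and N l :: real and a :: "nat \<Rightarrow> int" and f :: "nat \<Rightarrow> real"
  defines "f \<equiv> \<lambda>j. N * (1 - real d / (real k - real j + real d)) - l"
  assumes k2: "2 \<le> k" and N: "N > 0" and l: "l \<ge> 0"
    and ld: "l * (real d + 1) \<le> N" and lk: "l * (real k + 1) \<le> N"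
    and sym: "i \<le> k \<Longrightarrow> a (k - i) = a i"
    and low: "2 * j < k \<Longrightarrow> real_of_int (a j) = real (k choose j) * f j"
    and middle: "k = 2 * m \<Longrightarrow> real_of_int (a m) = real (k choose m) * (f m + l / (real m + 1))"
begin

text \<open>With x = k - j, at least 2, the claim is l (x + d) < N x. For d > 0 it follows from x +
  d < (d + 1) x and \<open>ld\<close>; for d = 0 the strictness comes from
  \<open>lk\<close>.\<close>

lemma f_pos:
  assumes j: "2 * j < k"
  shows "f j > 0"
proof -
  define x where "x = real k - real j"
  have "j + 2 \<le> k" using j k2 by linarith
  then have "real (j + 2) \<le> real k" by (simp only: of_nat_le_iff)
  then have x: "x \<ge> 2" by (simp add: x_def)
  have "l * (x + real d) < N * x"
  proof (cases "l = 0")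
    case False
    then have l0: "l > 0" using l by simp
    show ?thesis
    proof (cases "d = 0")
      case True
      have "l * 1 < l * (real k + 1)" using l0 k2 by (intro mult_strict_left_mono) auto
      then show ?thesis using True lk x by simp
    next
      case False
      then have "1 * real d < x * real d" using x by (intro mult_strict_right_mono) auto
      then have "x + real d < (real d + 1) * x" by (simp add: algebra_simps)
      then have "l * (x + real d) < l * ((real d + 1) * x)" using l0 by (rule mult_strict_left_mono)
      also have "\<dots> = (l * (real d + 1)) * x" by simp
      also have "\<dots> \<le> N * x" using ld x by (intro mult_right_mono) auto
      finally show ?thesis .
    qed
  qed (use N x in simp)
  moreover have "f j * (x + real d) = N * x - l * (x + real d)"
    unfolding f_def x_def[symmetric] using x by (simp add: field_simps)
  ultimately have "f j * (x + real d) > 0" by simp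
  then show ?thesis using x by (simp add: zero_less_mult_iff)
qed

text \<open>Multiplying by (x + d) (x + 1), where x = m, turns the claim into positivity of x (N (x
  + 1) - l (x + d)).\<close>

lemma middle_pos:
  assumes m: "k = 2 * m"
  shows "f m + l / (real m + 1) > 0"
proof -
  have m1: "real m \<ge> 1" using m k2 by simp
  define x where "x = real m"
  have "l * (x + real d) < N * (x + 1)"
  proof (cases "l = 0")
    case False
    then have l0: "l > 0" using l by simp
    have "x + real d < (real d + 1) * (x + 1)"
      using m1 by (simp add: x_def algebra_simps add_pos_nonneg)
    then have "l * (x + real d) < l * ((real d + 1) * (x + 1))" using l0 by (rule mult_strict_left_mono)
    also have "\<dots> = (l * (real d + 1)) * (x + 1)" by simp
    also have "\<dots> \<le> N * (x + 1)" using ld m1 by (intro mult_right_mono) (auto simp: x_def)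
    finally show ?thesis .
  qed (use N m1 in \<open>simp add: x_def\<close>)
  then have "0 < x * (N * (x + 1) - l * (x + real d))" using m1 by (simp add: x_def)
  also have "x * (N * (x + 1) - l * (x + real d)) =
      (f m + l / (x + 1)) * ((x + real d) * (x + 1))"
  proof -
    have "f m = N * (1 - real d / (x + real d)) - l" unfolding f_def x_def using m by simp
    then have 1: "f m * (x + real d) = N * x - l * (x + real d)"
      using m1 by (simp add: x_def[symmetric] field_simps)
    have 2: "l / (x + 1) * (x + 1) = l" using m1 by (simp add: x_def)
    have "(f m + l / (x + 1)) * ((x + real d) * (x + 1)) =
        (f m * (x + real d)) * (x + 1) + (l / (x + 1) * (x + 1)) * (x + real d)"
      by (simp only: ring_distribs mult_ac)
    then show ?thesis unfolding 1 2 by (simp add: algebra_simps)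
  qed
  finally have "0 < (f m + l / (x + 1)) * ((x + real d) * (x + 1))" .
  moreover have "0 < (x + real d) * (x + 1)" using m1 by (simp add: x_def add_pos_nonneg)
  ultimately show ?thesis unfolding x_def by (rule zero_less_mult_pos2)
qed

lemma pos_low:
  assumes "2 * j \<le> k"
  shows "a j > 0"
proof -
  have "real (k choose j) > 0" using assms by simp
  then have "real_of_int (a j) > 0"
    using low[of j] middle[of j] f_pos[of j] middle_pos[of j] assms
    by (cases "2 * j = k") (auto simp del: of_int_0_less_iff)
  then show ?thesis by simp
qed

lemma pos:
  assumes "i \<le> k"
  shows "a i > 0"
  using pos_low[of i] pos_low[of "k - i"] sym[OF assms] assms by (cases "2 * i \<le> k") auto

lemma le_middle_odd:
  assumes k: "k = 2 * m + 1"
  shows "a (m - 1) \<le> a m"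
proof (cases m)
  case (Suc j)
  define x where "x = real m"
  have x1: "x \<ge> 1" using Suc by (simp add: x_def)
  have kx: "real k = 2 * x + 1" "real (m - 1) = x - 1" using k Suc by (auto simp: x_def)
  have "f (m - 1) = N * (1 - real d / (x + 2 + real d)) - l"
    "f m = N * (1 - real d / (x + 1 + real d)) - l"
    unfolding f_def kx x_def[symmetric] by (simp_all add: algebra_simps)
  then have "x * f (m - 1) \<le> (x + 2) * f m"
    using middle_odd_ineq[OF x1 _ N ld] by simp
  then have "real (k choose (m - 1)) * (x * f (m - 1)) \<le> real (k choose (m - 1)) * ((x + 2) * f m)"
    by (intro mult_left_mono) auto
  also have "\<dots> = ((x + 2) * real (k choose (m - 1))) * f m" by simp
  also have "(x + 2) * real (k choose (m - 1)) = x * real (k choose m)"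
    using real_binomial_step[of "m - 1" k] k Suc kx by (simp add: x_def)
  finally have "x * (real (k choose (m - 1)) * f (m - 1)) \<le> x * (real (k choose m) * f m)"
    by (simp only: mult_ac)
  then have "real_of_int (a (m - 1)) \<le> real_of_int (a m)"
    using low[of "m - 1"] low[of m] k x1 by simp
  then show ?thesis by simp
qed simp

lemma le_middle_even:
  assumes k: "k = 2 * m"
  shows "a (m - 1) \<le> a m"
proof -
  define x where "x = real m"
  have m1: "m \<ge> 1" using k k2 by simp
  then have x1: "x \<ge> 1" by (simp add: x_def)
  have kx: "real k = 2 * x" "real (m - 1) = x - 1" using k m1 by (auto simp: x_def)
  have "f (m - 1) = N * (1 - real d / (x + 1 + real d)) - l"
    "f m = N * (1 - real d / (x + real d)) - l"
    unfolding f_def kx x_def[symmetric] by (simp_all add: algebra_simps)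
  then have "x * f (m - 1) \<le> (x + 1) * (f m + l / (x + 1))"
    using middle_even_ineq[OF x1 _ N, of "real d" l] by simp
  then have "real (k choose (m - 1)) * (x * f (m - 1)) \<le>
      real (k choose (m - 1)) * ((x + 1) * (f m + l / (x + 1)))"
    by (intro mult_left_mono) auto
  also have "\<dots> = ((x + 1) * real (k choose (m - 1))) * (f m + l / (x + 1))" by simp
  also have "(x + 1) * real (k choose (m - 1)) = x * real (k choose m)"
    using real_binomial_step[of "m - 1" k] k m1 kx by (simp add: x_def)
  finally have "x * (real (k choose (m - 1)) * f (m - 1)) \<le> x * (real (k choose m) * (f m + l / (x + 1)))"
    by (simp only: mult_ac)
  then have "real (k choose (m - 1)) * f (m - 1) \<le> real (k choose m) * (f m + l / (x + 1))"
    using x1 by simp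
  then have "real_of_int (a (m - 1)) \<le> real_of_int (a m)"
    using low[of "m - 1"] middle[of m] k m1 by (simp add: x_def)
  then show ?thesis by simp
qed

lemma log_concave_middle:
  assumes k: "k = 2 * m" and m: "m \<ge> 2"
  shows "a (m - 2) * a m \<le> (a (m - 1))\<^sup>2"
proof -
  define x where "x = real m"
  have x2: "x \<ge> 2" using m by (simp add: x_def)
  have kx: "real k = 2 * x" "real (m - 1) = x - 1" "real (m - 2) = x - 2"
    using k m by (auto simp: x_def)
  have fs: "f (m - 1) = N * (1 - real d / (x + 1 + real d)) - l"
    "f m = N * (1 - real d / (x + real d)) - l"
    "f (m - 2) = N * (1 - real d / (x + 2 + real d)) - l"
    unfolding f_def kx x_def[symmetric] by (simp_all add: algebra_simps)
  define F where "F = f m + l / (x + 1)"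
  define c where "c = real (k choose (m - 1))"
  define p where "p = real (k choose m)"
  define q where "q = real (k choose (m - 2))"
  have p: "x * p = (x + 1) * c"
    using real_binomial_step[of "m - 1" k] k m kx by (simp add: x_def p_def c_def)
  have q: "(x + 2) * q = (x - 1) * c"
  proof -
    have "m - 2 + 1 = m - 1" using m by simp
    then show ?thesis using real_binomial_step[of "m - 2" k] k m kx by (simp add: x_def q_def c_def)
  qed
  have "0 \<le> N * (1 - real d / (x + real d)) - l + l / (x + 1)"
    using middle_pos[OF k] by (simp add: fs x_def)
  then have "(x\<^sup>2 - 1) * (f (m - 2) * F) \<le> x * (x + 2) * (f (m - 1))\<^sup>2"
    using middle_log_concave_ineq[OF x2 _ N l ld] lk unfolding F_def fs kx by simp
  then have le: "c\<^sup>2 * ((x\<^sup>2 - 1) * (f (m - 2) * F)) \<le> c\<^sup>2 * (x * (x + 2) * (f (m - 1))\<^sup>2)"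
    by (rule mult_left_mono) simp
  have "(x * (x + 2)) * ((q * f (m - 2)) * (p * F)) = ((x + 2) * q) * (x * p) * (f (m - 2) * F)"
    by (simp only: mult_ac)
  also have "\<dots> = c\<^sup>2 * ((x\<^sup>2 - 1) * (f (m - 2) * F))"
    unfolding p q by (simp add: power2_eq_square algebra_simps)
  also note le
  also have "c\<^sup>2 * (x * (x + 2) * (f (m - 1))\<^sup>2) = (x * (x + 2)) * (c * f (m - 1))\<^sup>2"
    by (simp only: mult_ac power_mult_distrib)
  finally have "(x * (x + 2)) * ((q * f (m - 2)) * (p * F)) \<le> (x * (x + 2)) * (c * f (m - 1))\<^sup>2" .
  then have "(q * f (m - 2)) * (p * F) \<le> (c * f (m - 1))\<^sup>2"
    using x2 by (subst (asm) mult_le_cancel_left_pos) auto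
  moreover have "real_of_int (a (m - 2)) = q * f (m - 2)" "real_of_int (a (m - 1)) = c * f (m - 1)"
    "real_of_int (a m) = p * F"
    using low[of "m - 2"] low[of "m - 1"] middle[OF k] k m
    by (auto simp: q_def c_def p_def F_def x_def)
  ultimately have "real_of_int (a (m - 2) * a m) \<le> real_of_int ((a (m - 1))\<^sup>2)" by simp
  then show ?thesis by (simp only: of_int_le_iff)
qed

text \<open>Concavity of f and the inequality of arithmetic and geometric means make f log-concave;
  this is multiplied with log-concavity of the binomials.\<close>

lemma log_concave_low:
  assumes j: "2 * (j + 2) < k"
  shows "a j * a (j + 2) \<le> (a (j + 1))\<^sup>2"
proof -
  define u where "u = real k - real (j + 1) + real d"
  have "j + 2 < k" using j by presburger
  then have "real (j + 2) < real k" by (simp only: of_nat_less_iff)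
  then have u: "u > 1" by (simp add: u_def)
  have fs: "f j = N * (1 - real d / (u + 1)) - l" "f (j + 1) = N * (1 - real d / u) - l"
    "f (j + 2) = N * (1 - real d / (u - 1)) - l"
    unfolding f_def u_def by (simp_all add: algebra_simps)
  have fp: "f j > 0" "f (j + 1) > 0" "f (j + 2) > 0" using f_pos j by auto
  have "2 / u \<le> 1 / (u + 1) + 1 / (u - 1)"
    using u by (simp add: divide_simps) (simp add: algebra_simps)
  then have "N * real d * (2 / u) \<le> N * real d * (1 / (u + 1) + 1 / (u - 1))"
    using N by (intro mult_left_mono) auto
  then have conc: "f j + f (j + 2) \<le> 2 * f (j + 1)" unfolding fs by (simp add: algebra_simps)
  have "4 * (f j * f (j + 2)) \<le> (f j + f (j + 2))\<^sup>2"
    using zero_le_power2[of "f j - f (j + 2)"] by (simp add: power2_eq_square algebra_simps)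
  also have "\<dots> \<le> (2 * f (j + 1))\<^sup>2" using conc fp by (intro power_mono) auto
  finally have ff: "f j * f (j + 2) \<le> (f (j + 1))\<^sup>2" by (simp add: power_mult_distrib)
  have "real_of_int (a j * a (j + 2)) =
      (real (k choose j) * real (k choose (j + 2))) * (f j * f (j + 2))"
    using low[of j] low[of "j + 2"] j by simp
  also have "\<dots> \<le> (real (k choose (j + 1)))\<^sup>2 * (f (j + 1))\<^sup>2"
    using binomial_log_concave[of j k] ff fp j by (intro mult_mono) auto
  also have "\<dots> = real_of_int ((a (j + 1))\<^sup>2)"
    using low[of "j + 1"] j by (simp add: power_mult_distrib)
  finally show ?thesis by (simp only: of_int_le_iff)
qed

text \<open>The cases depend on whether i + 1 is below, at or beyond the middle. Beyond it, symmetry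
  replaces a(i + 1) by a(i) or a(i - 1), and the inequality a(i - 1) \<le> a(i) suffices.\<close>

lemma log_concave_half:
  assumes i: "1 \<le> i" "2 * i \<le> k"
  shows "a (i - 1) * a (i + 1) \<le> (a i)\<^sup>2"
proof -
  have ai: "a i \<ge> 0" using pos[of i] i by simp
  have "2 * (i + 1) < k \<or> k = 2 * (i + 1) \<or> k = 2 * i + 1 \<or> k = 2 * i"
    using i by arith
  then consider "2 * (i + 1) < k" | "k = 2 * (i + 1)" | "k = 2 * i + 1" | "k = 2 * i"
    by blast
  then show ?thesis
  proof cases
    case 1
    then show ?thesis using log_concave_low[of "i - 1"] i by (simp add: numeral_2_eq_2)
  next
    case 2
    then show ?thesis using log_concave_middle[of "i + 1"] i by simp
  next
    case 3
    then have "a (i + 1) = a i" using sym[of i] by simp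
    then show ?thesis
      using le_middle_odd[OF 3] ai by (simp add: power2_eq_square mult_right_mono)
  next
    case 4
    have "k - (i - 1) = i + 1" using 4 i by simp
    then have "a (i + 1) = a (i - 1)" using sym[of "i - 1"] 4 by simp
    moreover have "0 < a (i - 1)" using 4 by (intro pos) simp
    ultimately show ?thesis
      using le_middle_even[OF 4] ai by (simp add: power2_eq_square mult_mono less_imp_le)
  qed
qed

text \<open>Descending induction from the middle: for positive log-concave sequences a(i + 1) \<le>
  a(i + 2) implies a(i) \<le> a(i + 1).\<close>

lemma increasing:
  assumes "2 * (i + 1) \<le> k"
  shows "a i \<le> a (i + 1)"
  using assms
proof (induction "k - i" arbitrary: i rule: less_induct)
  case less
  have "2 * (i + 2) \<le> k \<or> k = 2 * (i + 1) + 1 \<or> k = 2 * (i + 1)"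
    using less.prems by arith
  then consider "2 * (i + 2) \<le> k" | "k = 2 * (i + 1) + 1" | "k = 2 * (i + 1)"
    by blast
  then show ?case
  proof cases
    case 1
    then have IH: "a (i + 1) \<le> a (i + 2)" using less.hyps[of "i + 1"] by simp
    have p: "a i > 0" "a (i + 1) > 0" using pos[of i] pos[of "i + 1"] less.prems by auto
    have "a i * a (i + 1) \<le> a i * a (i + 2)" using IH p by (intro mult_left_mono) auto
    also have "\<dots> \<le> a (i + 1) * a (i + 1)"
      using log_concave_half[of "i + 1"] less.prems by (simp add: power2_eq_square)
    finally show ?thesis using p by (simp add: mult_le_cancel_right)
  next
    case 2
    then show ?thesis using le_middle_odd[OF 2] by simp
  next
    case 3
    then show ?thesis using le_middle_even[OF 3] by simp
  qed
qed

lemma unimodal: "unimodal k a"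
  unfolding unimodal_def
proof (intro exI[of _ "k div 2"] conjI allI impI)
  fix i assume i: "k div 2 \<le> i \<and> i < k"
  show "a (Suc i) \<le> a i"
  proof (cases "2 * i \<ge> k")
    case True
    have "a (k - Suc i) \<le> a (k - Suc i + 1)" using True i by (intro increasing) auto
    moreover have "k - Suc i + 1 = k - i" using i by (simp add: Suc_diff_Suc)
    ultimately show ?thesis using sym[of i] sym[of "Suc i"] i by simp
  next
    case False
    then have "k = 2 * i + 1" using i by linarith
    then show ?thesis using sym[of i] by simp
  qed
next
  fix i assume "i < k div 2"
  then show "a i \<le> a (Suc i)" using increasing[of i] by simp
qed simp

lemma log_concave: "log_concave k a"
  unfolding log_concave_def
proof (intro allI impI)
  fix i assume i: "0 < i \<and> i < k"
  show "a (i - 1) * a (i + 1) \<le> (a i)\<^sup>2"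
  proof (cases "2 * i \<le> k")
    case True
    then show ?thesis using log_concave_half[of i] i by simp
  next
    case False
    have "a (k - i - 1) * a (k - i + 1) \<le> (a (k - i))\<^sup>2"
      using False i by (intro log_concave_half) auto
    moreover have "k - (i + 1) = k - i - 1" "k - (i - 1) = k - i + 1" using i by auto
    ultimately show ?thesis
      using sym[of i] sym[of "i + 1"] sym[of "i - 1"] i by (simp add: mult.commute)
  qed
qed

lemma no_internal_zeros: "no_internal_zeros k a"
  unfolding no_internal_zeros_def
proof
  assume "\<exists>i j l. i < j \<and> j < l \<and> l \<le> k \<and> a i \<noteq> 0 \<and> a l \<noteq> 0 \<and> a j = 0"
  then obtain j l where "j < l" "l \<le> k" "a j = 0" by blast
  then show False using pos[of j] by simp
qed

end

section \<open>The coefficients in the form required by \<open>sparse_coefficients\<close>\<close>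

lemma binomial_split:
  assumes j: "j < k" "k \<le> n"
  shows "real (n choose j) * real (n - j - 1 choose (k - j - 1)) =
    real (n choose k) * real (k choose j) * ((real k - real j) / (real n - real j))"
proof -
  \<comment> \<open>Absorption trades the second binomial for \<open>n - j choose (k - j)\<close>;
    then \<open>choose_mult\<close> regroups the product around \<open>n choose k\<close>.\<close>
  have "Suc (k - j - 1) * (n - j choose Suc (k - j - 1)) = (n - j) * (n - j - 1 choose (k - j - 1))"
    by (rule binomial_absorption)
  then have "(k - j) * (n - j choose (k - j)) = (n - j) * (n - j - 1 choose (k - j - 1))"
    using j by (simp add: Suc_diff_Suc)
  from arg_cong[OF this, of real]
  have "(real k - real j) * real (n - j choose (k - j)) = (real n - real j) * real (n - j - 1 choose (k - j - 1))"
    using j by (simp add: of_nat_diff)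
  then have "real (n - j - 1 choose (k - j - 1)) =
      (real k - real j) / (real n - real j) * real (n - j choose (k - j))"
    using j by (simp add: field_simps)
  moreover have "real (n choose k) * real (k choose j) = real (n choose j) * real (n - j choose (k - j))"
    using choose_mult[of j k n] j by (simp flip: of_nat_mult)
  ultimately show ?thesis by simp
qed

context sparse_matroid
begin

lemma sparse_coefficients:
  assumes k2: "2 \<le> k"
  shows "sparse_coefficients k (n - k) (real (n choose k)) (real (card CC))
    (coeff (inverse_Z_loopless M))"
proof
  let ?a = "coeff (inverse_Z_loopless M)"
  let ?d = "n - k"
  let ?f = "\<lambda>j. real (n choose k) * (1 - real ?d / (real k - real j + real ?d)) - real (card CC)"
  have dn: "real k - real j + real ?d = real n - real j" for j
    using k_le_n by (simp add: of_nat_diff)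
  have f: "?f j = real (n choose k) * ((real k - real j) / (real n - real j)) - real (card CC)"
    if "j < k" for j
  proof -
    have "real n - real j > 0" using that k_le_n by simp
    then have "1 - real ?d / (real n - real j) = (real k - real j) / (real n - real j)"
      using k_le_n by (simp add: field_simps of_nat_diff)
    then show ?thesis unfolding dn by simp
  qed
  show "2 \<le> k" by fact
  show "0 < real (n choose k)" using k_le_n by simp
  show "0 \<le> real (card CC)" by simp
  show "real (card CC) * (real ?d + 1) \<le> real (n choose k)"
    using of_nat_mono[OF card_CC_corank, where 'a = real]
    by (simp only: of_nat_mult of_nat_add of_nat_1)
  show "real (card CC) * (real k + 1) \<le> real (n choose k)"
    using of_nat_mono[OF card_CC_rank, where 'a = real]
    by (simp only: of_nat_mult of_nat_add of_nat_1)
  show "?a (k - i) = ?a i" if "i \<le> k" for i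
    using inverse_Z_loopless_palindromic[OF matroid loopless, of i] that by (simp add: rk_eq)
  show "real_of_int (?a j) = real (k choose j) * ?f j" if j: "2 * j < k" for j
  proof -
    have jk: "j < k" "j \<le> k" using j by auto
    have "?a j = ?a (k - j)"
      using inverse_Z_loopless_palindromic[OF matroid loopless, of j] jk by (simp add: rk_eq)
    \<comment> \<open>The coefficient is read off at the mirror image, where Q plays no
      part.\<close>
    also have "\<dots> = ycoeff (k - j)" using j by (intro coeff_inverse_Z_high) auto
    also have "\<dots> = int (n choose j) * int (n - j - 1 choose (k - j - 1)) - int (card CC) * int (k choose j)"
      using jk k_le_n binomial_symmetric[of j k] by (simp add: ycoeff_def)
    finally have "real_of_int (?a j) =
        real (n choose j) * real (n - j - 1 choose (k - j - 1)) - real (card CC) * real (k choose j)"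
      by simp
    then show ?thesis
      unfolding f[OF jk(1)] binomial_split[OF jk(1) k_le_n] by (simp only: algebra_simps)
  qed
  show "real_of_int (?a m) = real (k choose m) * (?f m + real (card CC) / (real m + 1))"
    if m: "k = 2 * m" for m
  proof -
    have mk: "m < k" "m \<ge> 1" using m k2 by auto
    have "real_of_int (?a m) =
        real (n choose m) * real (n - m - 1 choose (k - m - 1)) - real (card CC) * real (k choose (m - 1))"
      using coeff_inverse_Z_middle[OF m] m by simp
    \<comment> \<open>Replacing \<open>k choose (m - 1)\<close> by m / (m + 1) times
      \<open>k choose m\<close> produces the correction l / (m + 1).\<close>
    also have "real (k choose (m - 1)) = real (k choose m) * (1 - 1 / (real m + 1))"
      using real_binomial_step[of "m - 1" k] m mk by (simp add: of_nat_diff field_simps)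
    finally show ?thesis
      unfolding f[OF mk(1)] binomial_split[OF mk(1) k_le_n] by (simp add: algebra_simps)
  qed
qed

end

theorem theorem1p6:
  fixes M :: "'a matroid" and k n :: nat
  assumes "is_matroid M"
    and "sparse_paving M"
    and "rk M = k"
    and "card (ground M) = n"
  shows "unimodal k (coeff (inverse_Z M)) \<and>
         (log_concave k (coeff (inverse_Z M)) \<and> no_internal_zeros k (coeff (inverse_Z M)))"
proof (cases "k \<le> 1")
  case True
  \<comment> \<open>With at most two terms, every sequence has all three properties.\<close>
  have "unimodal k a" for a
  proof (cases "k = 1 \<and> a 0 \<le> a 1")
    case True
    then show ?thesis unfolding unimodal_def by (intro exI[of _ 1]) auto
  next
    case False
    then show ?thesis using \<open>k \<le> 1\<close> unfolding unimodal_def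
      by (intro exI[of _ 0]) (auto simp: le_Suc_eq)
  qed
  moreover have "log_concave k a" "no_internal_zeros k a" for a
    using True by (auto simp: log_concave_def no_internal_zeros_def)
  ultimately show ?thesis by blast
next
  case False
  then have k2: "2 \<le> k" by simp
  interpret sparse_matroid M k "{C. C \<subseteq> ground M \<and> card C = k \<and> C \<notin> indep M}"
    by (rule sparse_matroid_of_sparse_paving[OF assms(1,2,3) k2])
  \<comment> \<open>In rank at least 2 there are no loops to delete.\<close>
  have Z: "inverse_Z M = inverse_Z_loopless M"
    using loopless by (simp add: inverse_Z_def deletion_def loopless_def restriction_ground assms(1))
  from sparse_coefficients[OF k2] show ?thesis
    unfolding Z
    by (intro conjI sparse_coefficients.unimodal sparse_coefficients.log_concave
        sparse_coefficients.no_internal_zeros)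
qed

end
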